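(* Let $1<p<q<\infty$. There exist an invertible function $\varphi:[0,1]\to[0,1]$ and a constant $c\ge1$ with $$c^{-1}t\le\varphi(t)^{\frac1p-\frac1q}\bigl(1-\log\varphi(t)\bigr)^{\frac{p-q+pq}{pq}}\le c\,t\quad(0<t<1),$$ such that, with constants independent of $f$ and $t$, for all $f\in L^{(p}(\Omega)+L^{q)}(\Omega)$ and all $t\in(0,1)$, $$K\bigl(f,t;L^{(p},L^{q)}\bigr)\approx\int_0^{\varphi(t)}(1-\log s)^{-\frac1p}\Bigl(\int_0^s f_*^p\Bigr)^{\frac1p}\frac{ds}{s}+(1-\log t)^{\frac{p-1}{p}}\Bigl(\int_0^{\varphi(t)}f_*^p\Bigr)^{\frac1p}+t\sup_{\varphi(t)<s<1}(1-\log s)^{-\frac1q}\Bigl(\int_s^1 f_*^q\Bigr)^{\frac1q}.$$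
   Context: $\Omega\subset\mathbb R^n$ is a bounded open set with $|\Omega|=1$; $f_*$ is the decreasing rearrangement of $|f|$ on $(0,1)$; $\log$ is the natural logarithm. Small Lebesgue space $L^{(p}(\Omega)$ ($1<p<\infty$): measurable $f$ with $\|f\|_{(p}=\int_0^1(1-\log t)^{-1/p}(\int_0^t f_*^p)^{1/p}\frac{dt}{t}<\infty$. Grand Lebesgue space $L^{q)}(\Omega)$ ($1<q<\infty$): measurable $f$ with $\|f\|_{q)}=\sup_{0<t<1}(1-\log t)^{-1/q}(\int_t^1 f_*^q)^{1/q}<\infty$. K-functional: $K(g,t;X_0,X_1)=\inf_{g=g_0+g_1}(\|g_0\|_{X_0}+t\|g_1\|_{X_1})$. *)

theory Defs
  imports "HOL-Analysis.Analysis"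
begin

definition ennpow :: "ennreal \<Rightarrow> real \<Rightarrow> ennreal" where
  "ennpow x a = (if x = \<infinity> then \<infinity> else ennreal (enn2real x powr a))"

definition distrib_fun :: "'a::euclidean_space set \<Rightarrow> ('a \<Rightarrow> real) \<Rightarrow> real \<Rightarrow> ennreal" where
  "distrib_fun \<Omega> f y = emeasure lebesgue {x \<in> \<Omega>. \<bar>f x\<bar> > y}"

definition rearr :: "'a::euclidean_space set \<Rightarrow> ('a \<Rightarrow> real) \<Rightarrow> real \<Rightarrow> real" where
  "rearr \<Omega> f t = Inf {y::real. 0 \<le> y \<and> distrib_fun \<Omega> f y \<le> ennreal t}"

definition rint :: "'a::euclidean_space set \<Rightarrow> ('a \<Rightarrow> real) \<Rightarrow> real \<Rightarrow> real \<Rightarrow> real \<Rightarrow> ennreal" where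
  "rint \<Omega> f p a b = (\<integral>\<^sup>+ s. indicator {a<..<b} s * ennreal (rearr \<Omega> f s powr p) \<partial>lborel)"

definition small_norm :: "'a::euclidean_space set \<Rightarrow> real \<Rightarrow> ('a \<Rightarrow> real) \<Rightarrow> ennreal" where
  "small_norm \<Omega> p f = (\<integral>\<^sup>+ t. indicator {0<..<1} t *
      ennreal ((1 - ln t) powr (-1/p) / t) * ennpow (rint \<Omega> f p 0 t) (1/p) \<partial>lborel)"

definition grand_norm :: "'a::euclidean_space set \<Rightarrow> real \<Rightarrow> ('a \<Rightarrow> real) \<Rightarrow> ennreal" where
  "grand_norm \<Omega> q f = (SUP t\<in>{0<..<1::real}.
      ennreal ((1 - ln t) powr (-1/q)) * ennpow (rint \<Omega> f q t 1) (1/q))"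

definition decomps :: "'a::euclidean_space set \<Rightarrow> ('a \<Rightarrow> real) \<Rightarrow> (('a \<Rightarrow> real) \<times> ('a \<Rightarrow> real)) set" where
  "decomps \<Omega> g = {(g0, g1). g0 \<in> borel_measurable lebesgue \<and> g1 \<in> borel_measurable lebesgue \<and>
      (\<forall>x\<in>\<Omega>. g x = g0 x + g1 x)}"

definition Kfun :: "'a::euclidean_space set \<Rightarrow> real \<Rightarrow> real \<Rightarrow> ('a \<Rightarrow> real) \<Rightarrow> real \<Rightarrow> ennreal" where
  "Kfun \<Omega> p q g t = (INF d\<in>decomps \<Omega> g. small_norm \<Omega> p (fst d) + ennreal t * grand_norm \<Omega> q (snd d))"

definition in_sum_space :: "'a::euclidean_space set \<Rightarrow> real \<Rightarrow> real \<Rightarrow> ('a \<Rightarrow> real) \<Rightarrow> bool" where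
  "in_sum_space \<Omega> p q f \<longleftrightarrow> f \<in> borel_measurable lebesgue \<and>
     (\<exists>d\<in>decomps \<Omega> f. small_norm \<Omega> p (fst d) < \<infinity> \<and> grand_norm \<Omega> q (snd d) < \<infinity>)"

end

theory Submission
  imports Defs
begin

text \<open>
  Put \<open>\<alpha> = 1/p - 1/q\<close> and let \<open>\<phi>\<close> be the inverse of \<open>x \<mapsto> x\<^sup>\<alpha> (1 - \<alpha> ln x)\<^bsup>1-\<alpha>\<^esup>\<close>.
  For the upper bound, \<open>f\<close> is cut at the level \<open>f\<^sub>*(\<phi> t)\<close>: the large part has a rearrangement
  supported in \<open>(0, \<phi> t)\<close>, the small part one bounded by \<open>f\<^sub>*(\<phi> t)\<close>.
  For the lower bound, \<open>f = g + h\<close> gives \<open>f\<^sub>*(s) \<le> g\<^sub>*(s/2) + h\<^sub>*(s/2)\<close>, and everything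
  follows from two consequences of monotonicity: the grand norm \<open>N\<close> of \<open>h\<close> controls
  \<open>h\<^sub>*(u) \<lesssim> N u\<^bsup>-1/q\<^esup> (1 - ln u)\<^bsup>1/q\<^esup>\<close>, and the small norm \<open>M\<close> of \<open>g\<close> controls
  \<open>(\<integral>\<^sub>0\<^sup>u g\<^sub>*\<^sup>p)\<^bsup>1/p\<^esup> \<lesssim> M (1 - ln u)\<^bsup>1/p-1\<^esup>\<close>. Integrating these power-logarithmic bounds produces
  exactly the factor \<open>\<phi>\<^sup>\<alpha> (1 - ln \<phi>)\<^bsup>1-\<alpha>\<^esup> \<approx> t\<close>.
\<close>

section \<open>Power-logarithmic integrals\<close>

text \<open>The plain function \<open>x powr \<alpha> * (1 - ln x) powr (1 - \<alpha>)\<close> need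
  not be monotone near 1, so it may have no inverse on [0, 1]; the factor \<alpha> on the logarithm
  repairs this at the price of bounded factors. Moreover \<open>1 - ln t\<close> and
  \<open>1 - ln \<phi>\<close> are comparable, so the weight of the middle term may be read at
  either point. Only rearrangements enter the norms, so both bounds are proved for arbitrary
  decreasing functions: for the upper bound \<open>h\<close> and \<open>k\<close> lie below
  \<open>F\<close>, for the lower bound \<open>F\<close> lies below a sum of dilates of
  \<open>h\<close> and \<open>k\<close>. The small norm controls integrals over (0, u) only while
  \<open>- ln u\<close> is comparable with \<open>1 - ln u\<close>, which fails near 1. Halving the
  argument removes the difficulty: the integrals that arise for \<open>g\<close> stay within (0,
  1/2). The exponents fit because of \<open>(1 - 1/p) + 1/q = 1 - \<alpha>\<close>: the logarithmic
  weight of the middle term and the logarithm lost in the pointwise grand-norm bound combine to the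
  one in the definition of \<phi>.\<close>

lemma ennpow_ennreal [simp]: "0 \<le> x \<Longrightarrow> ennpow (ennreal x) a = ennreal (x powr a)"
  by (simp add: ennpow_def)

lemma ennpow_top [simp]: "ennpow top a = top"
  by (simp add: ennpow_def)

lemma ennpow_mono: "x \<le> y \<Longrightarrow> 0 \<le> a \<Longrightarrow> ennpow x a \<le> ennpow y a"
  by (cases x; cases y) (auto intro!: ennreal_leI powr_mono2 simp: top_unique)

lemma ennpow_cmult:
  assumes "0 < c"
  shows "ennpow (ennreal c * x) a = ennreal (c powr a) * ennpow x a"
proof (cases x)
  case (real r)
  then show ?thesis
    using assms by (simp add: ennreal_mult[symmetric] powr_mult)
next
  case top
  then show ?thesis
    using assms by (simp add: ennreal_mult_top)
qed

text \<open>Replacing the sum by twice the maximum handles convex and concave powers alike; below,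
  the exponent is \<open>p\<close> under the integral and \<open>1/p\<close> or \<open>1/q\<close>
  outside it.\<close>

lemma powr_add_le:
  fixes x y :: real
  assumes "0 \<le> x" "0 \<le> y" "0 \<le> a"
  shows "(x + y) powr a \<le> 2 powr a * (x powr a + y powr a)"
proof -
  have "(x + y) powr a \<le> (2 * max x y) powr a"
    using assms by (intro powr_mono2) auto
  also have "\<dots> = 2 powr a * (max x y) powr a"
    using assms by (simp add: powr_mult)
  also have "\<dots> \<le> 2 powr a * (x powr a + y powr a)"
    by (intro mult_left_mono) (auto simp: max_def)
  finally show ?thesis .
qed

lemma ennpow_add_le:
  assumes "0 \<le> a"
  shows "ennpow (x + y) a \<le> ennreal (2 powr a) * (ennpow x a + ennpow y a)"
proof (cases x; cases y)
  fix r s :: real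
  assume "0 \<le> r" "x = ennreal r" "0 \<le> s" "y = ennreal s"
  with powr_add_le[of r s a] assms show ?thesis
    by (simp add: ennreal_plus[symmetric] ennreal_mult[symmetric] del: ennreal_plus)
qed (auto simp: ennreal_mult_top)

text \<open>Strict sublevel sets of a monotone function are intervals. This makes
  \<open>s \<mapsto> lnorm h p 0 s\<close> measurable whatever \<open>h\<close> is.\<close>

lemma borel_measurable_ennreal_mono:
  fixes f :: "real \<Rightarrow> ennreal"
  assumes "mono f"
  shows "f \<in> borel_measurable borel"
proof (rule borel_measurableI_less)
  fix y
  have "is_interval {x. f x < y}"
    unfolding is_interval_1 using assms by (auto simp: mono_def intro: le_less_trans)
  then show "{x \<in> space borel. f x < y} \<in> sets borel"
    by (simp add: real_interval_borel_measurable)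
qed

lemma ln_less_one: "0 < x \<Longrightarrow> x \<le> 1 \<Longrightarrow> ln (x::real) < 1"
  using ln_le_minus_one[of x] by linarith

section \<open>Explicit integrals of powers and of logarithmic weights, then of their
  products\<close>

lemma nn_integral_FTC_Ioo:
  fixes F f :: "real \<Rightarrow> real"
  assumes "a \<le> b" "\<And>x. a \<le> x \<Longrightarrow> x \<le> b \<Longrightarrow> (F has_real_derivative f x) (at x)"
    and "\<And>x. a < x \<Longrightarrow> x < b \<Longrightarrow> 0 \<le> f x"
  shows "(\<integral>\<^sup>+x. indicator {a<..<b} x * ennreal (f x) \<partial>lborel) = ennreal (F b - F a)"
proof -
  have "(f has_integral (F b - F a)) {a..b}"
    using assms by (intro fundamental_theorem_of_calculus)
      (auto simp: has_real_derivative_iff_has_vector_derivative[symmetric] intro: has_field_derivative_at_within)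
  then have "(f has_integral (F b - F a)) {a<..<b}"
    by (simp add: has_integral_Icc_iff_Ioo)
  from nn_integral_has_integral_lebesgue'[OF _ this] assms(3) show ?thesis
    by (simp add: mult.commute)
qed

lemma nn_integral_powr_0:
  fixes a x :: real
  assumes "0 < a" "0 \<le> x"
  shows "(\<integral>\<^sup>+u. indicator {0<..<x} u * ennreal (u powr (a - 1)) \<partial>lborel) = ennreal (x powr a / a)"
proof -
  have "((\<lambda>u. u powr (a - 1)) has_integral (x powr a / a)) {0..x}"
    using has_integral_powr_from_0[of "a - 1" x] assms by simp
  then have "((\<lambda>u. u powr (a - 1)) has_integral (x powr a / a)) {0<..<x}"
    by (simp add: has_integral_Icc_iff_Ioo)
  from nn_integral_has_integral_lebesgue'[OF _ this] show ?thesis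
    by (simp add: mult.commute)
qed

lemma nn_integral_powr_1:
  fixes a x :: real
  assumes "0 < a" "0 < x" "x \<le> 1"
  shows "(\<integral>\<^sup>+u. indicator {x<..<1} u * ennreal (u powr (- a - 1)) \<partial>lborel) \<le> ennreal (x powr (- a) / a)"
proof -
  have "(\<integral>\<^sup>+u. indicator {x<..<1} u * ennreal (u powr (- a - 1)) \<partial>lborel)
      = ennreal ((- (1 powr (-a)) / a) - (- (x powr (-a)) / a))"
    using assms
    by (intro nn_integral_FTC_Ioo) (auto intro!: derivative_eq_intros simp: field_simps)
  also have "\<dots> \<le> ennreal (x powr (- a) / a)"
    using assms by (intro ennreal_leI) simp
  finally show ?thesis .
qed

lemma nn_integral_inverse:
  fixes x :: real
  assumes "0 < x" "x \<le> 1"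
  shows "(\<integral>\<^sup>+u. indicator {x<..<1} u * ennreal (1 / u) \<partial>lborel) = ennreal (- ln x)"
proof -
  have "(\<integral>\<^sup>+u. indicator {x<..<1} u * ennreal (1 / u) \<partial>lborel) = ennreal (ln 1 - ln x)"
    using assms
    by (intro nn_integral_FTC_Ioo) (auto intro!: derivative_eq_intros simp: field_simps)
  then show ?thesis by simp
qed

text \<open>With \<open>r = 1/p\<close> this is the origin of the logarithmic factor in the middle
  term: it is the mass that the weight of the small norm has on (x, 1).\<close>

lemma nn_integral_log_weight:
  fixes x r :: real
  assumes "0 < x" "x \<le> 1" "r < 1"
  shows "(\<integral>\<^sup>+u. indicator {x<..<1} u * ennreal ((1 - ln u) powr (- r) / u) \<partial>lborel)
    \<le> ennreal ((1 - ln x) powr (1 - r) / (1 - r))"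
proof -
  have "(\<integral>\<^sup>+u. indicator {x<..<1} u * ennreal ((1 - ln u) powr (- r) / u) \<partial>lborel)
      = ennreal ((- ((1 - ln 1) powr (1 - r)) / (1 - r)) - (- ((1 - ln x) powr (1 - r)) / (1 - r)))"
  proof (intro nn_integral_FTC_Ioo)
    fix u :: real assume u: "x \<le> u" "u \<le> 1"
    with assms have "0 < u" "0 < 1 - ln u"
      using ln_less_one[of u] by auto
    then show "((\<lambda>u. - ((1 - ln u) powr (1 - r)) / (1 - r)) has_real_derivative (1 - ln u) powr (- r) / u) (at u)"
      using assms by (auto intro!: derivative_eq_intros simp: divide_simps)
  qed (use assms in auto)
  also have "\<dots> \<le> ennreal ((1 - ln x) powr (1 - r) / (1 - r))"
    using assms by (intro ennreal_leI) simp
  finally show ?thesis .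
qed

text \<open>A logarithm is absorbed by any positive power. With \<open>y = s / u\<close> one has
  \<open>1 - ln u \<le> (1 - ln s) * (1 + ln y)\<close>, and
  \<open>1 + ln y \<le> (1 / e) * y powr e\<close> follows from the exponential inequality. For
  \<open>e < 1\<close> the function itself decreases near 1, hence the factor
  \<open>1 / e\<close>.\<close>

lemma log_powr_almost_increasing:
  fixes u s e :: real
  assumes "0 < u" "u \<le> s" "s \<le> 1" "0 < e" "e \<le> 1"
  shows "(1 - ln u) * u powr e \<le> (1 / e) * ((1 - ln s) * s powr e)"
proof -
  define y where "y = s / u"
  have y: "1 \<le> y" "0 < s" using assms by (auto simp: y_def)
  have ls: "ln s \<le> 0" and ly: "0 \<le> ln y" using assms y by auto
  have lu: "ln u = ln s - ln y" using assms y by (simp add: y_def ln_div)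
  have "1 - ln u \<le> (1 - ln s) * (1 + ln y)"
    using mult_nonpos_nonneg[OF ls ly] by (simp add: lu algebra_simps)
  also have "1 + ln y \<le> (1 / e) * y powr e"
  proof -
    have "1 + e * ln y \<le> exp (e * ln y)" by (rule exp_ge_add_one_self)
    also have "\<dots> = y powr e" using y by (simp add: powr_def)
    finally have "1 + e * ln y \<le> y powr e" .
    moreover have "e * (1 + ln y) \<le> 1 + e * ln y" using assms by (simp add: algebra_simps)
    ultimately show ?thesis using assms by (simp add: field_simps)
  qed
  finally have "1 - ln u \<le> (1 - ln s) * ((1 / e) * y powr e)"
    using ls by (simp add: mult_left_mono)
  then have "(1 - ln u) * u powr e \<le> (1 - ln s) * ((1 / e) * y powr e) * u powr e"
    by (rule mult_right_mono) simp
  also have "\<dots> = (1 / e) * ((1 - ln s) * (y powr e * u powr e))" by simp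
  also have "y powr e * u powr e = s powr e"
    using assms y by (simp add: y_def powr_mult[symmetric])
  finally show ?thesis .
qed

text \<open>A small power of \<open>u\<close> is spent on moving the logarithm from \<open>u\<close>
  to the endpoint \<open>x\<close>, where it leaves the integral; what remains is a pure power,
  still integrable at 0.\<close>

lemma nn_integral_powr_log_0:
  fixes r :: real
  assumes "0 < r" "r < 1"
  shows "\<exists>C>0. \<forall>x. 0 < x \<and> x \<le> 1 \<longrightarrow>
    (\<integral>\<^sup>+u. indicator {0<..<x} u * ennreal (u powr (- r) * (1 - ln u) powr r) \<partial>lborel)
      \<le> ennreal (C * x powr (1 - r) * (1 - ln x) powr r)"
proof -
  \<comment> \<open>This \<open>e\<close> makes \<open>e * r\<close> at most half of the margin
    \<open>1 - r\<close>, so that \<open>d > 0\<close>; the minimum with 1 is there for the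
    absorption lemma.\<close>
  define e where "e = min 1 ((1 - r) / (2 * r))"
  define d where "d = 1 - r - e * r"
  have e: "0 < e" "e \<le> 1" using assms by (auto simp: e_def)
  define K where "K = 1 / e"
  have K: "0 < K" using e by (simp add: K_def)
  have "e * r \<le> (1 - r) / 2"
    using mult_right_mono[of e "(1 - r) / (2 * r)" r] assms by (simp add: e_def)
  then have d: "0 < d" using assms by (simp add: d_def)
  show ?thesis
  proof (intro exI[of _ "K powr r / d"] conjI allI impI)
    fix x :: real assume x: "0 < x \<and> x \<le> 1"
    define A where "A = K powr r * (1 - ln x) powr r * x powr (e * r)"
    have A: "0 \<le> A" by (simp add: A_def)
    have "u powr (- r) * (1 - ln u) powr r \<le> A * u powr (d - 1)" if "0 < u" "u < x" for u
    proof -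
      have u: "0 < 1 - ln u" "0 < 1 - ln x" using that x ln_less_one[of u] ln_less_one[of x] by auto
      have "((1 - ln u) * u powr e) powr r \<le> (K * ((1 - ln x) * x powr e)) powr r"
        using that x e u K assms log_powr_almost_increasing[of u x e, folded K_def] by (intro powr_mono2) auto
      then have "(1 - ln u) powr r * u powr (e * r) \<le> A"
        using u that x e K by (simp add: A_def powr_mult powr_powr mult_ac)
      then have "(1 - ln u) powr r * u powr (e * r) * u powr (d - 1) \<le> A * u powr (d - 1)"
        by (rule mult_right_mono) simp
      moreover have "u powr (e * r) * u powr (d - 1) = u powr (- r)"
        by (simp add: powr_add[symmetric] d_def)
      ultimately show ?thesis by (simp add: mult.assoc) (simp add: mult.commute)
    qed
    then have "(\<integral>\<^sup>+u. indicator {0<..<x} u * ennreal (u powr (- r) * (1 - ln u) powr r) \<partial>lborel)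
      \<le> (\<integral>\<^sup>+u. ennreal A * (indicator {0<..<x} u * ennreal (u powr (d - 1))) \<partial>lborel)"
      using A by (intro nn_integral_mono)
        (auto simp: indicator_def ennreal_mult[symmetric] intro!: ennreal_leI)
    also have "\<dots> = ennreal (A * (x powr d / d))"
      using d x A by (simp add: nn_integral_cmult nn_integral_powr_0 ennreal_mult[symmetric])
    also have "A * (x powr d / d) = K powr r / d * x powr (1 - r) * (1 - ln x) powr r"
    proof -
      have "x powr (e * r) * x powr d = x powr (1 - r)" by (simp add: powr_add[symmetric] d_def)
      then show ?thesis by (simp add: A_def mult_ac)
    qed
    finally show "(\<integral>\<^sup>+u. indicator {0<..<x} u * ennreal (u powr (- r) * (1 - ln u) powr r) \<partial>lborel)
      \<le> ennreal (K powr r / d * x powr (1 - r) * (1 - ln x) powr r)" .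
  qed (use K d in auto)
qed

text \<open>The mirror image: the power is now too singular at 0, so the left endpoint dominates.
  The absorption inequality is applied with \<open>x\<close> as the smaller point and raised to a
  negative power, which reverses it.\<close>

lemma nn_integral_powr_log_1:
  fixes r k :: real
  assumes "1 < r" "0 < k"
  shows "\<exists>C>0. \<forall>x. 0 < x \<and> x \<le> 1 \<longrightarrow>
    (\<integral>\<^sup>+u. indicator {x<..<1} u * ennreal (u powr (- r) * (1 - ln u) powr (- k)) \<partial>lborel)
      \<le> ennreal (C * x powr (1 - r) * (1 - ln x) powr (- k))"
proof -
  define e where "e = min 1 ((r - 1) / (2 * k))"
  define d where "d = r - 1 - e * k"
  have e: "0 < e" "e \<le> 1" using assms by (auto simp: e_def)
  define K where "K = 1 / e"
  have K: "0 < K" using e by (simp add: K_def)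
  have "e * k \<le> (r - 1) / 2"
    using mult_right_mono[of e "(r - 1) / (2 * k)" k] assms by (simp add: e_def)
  then have d: "0 < d" using assms by (simp add: d_def)
  show ?thesis
  proof (intro exI[of _ "K powr k / d"] conjI allI impI)
    fix x :: real assume x: "0 < x \<and> x \<le> 1"
    define A where "A = K powr k * (1 - ln x) powr (- k) * x powr (- (e * k))"
    have A: "0 \<le> A" by (simp add: A_def)
    have "u powr (- r) * (1 - ln u) powr (- k) \<le> A * u powr (- d - 1)" if "x < u" "u < 1" for u
    proof -
      have u: "0 < 1 - ln u" "0 < 1 - ln x" "0 < u" using that x ln_less_one[of u] ln_less_one[of x] by auto
      have "(K * ((1 - ln u) * u powr e)) powr (- k) \<le> ((1 - ln x) * x powr e) powr (- k)"
        using that x e u K assms log_powr_almost_increasing[of x u e, folded K_def] by (intro powr_mono2') auto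
      then have "K powr (- k) * ((1 - ln u) powr (- k) * u powr (- (e * k)))
          \<le> (1 - ln x) powr (- k) * x powr (- (e * k))"
        using u that x e K by (simp add: powr_mult powr_powr)
      then have "K powr k * (K powr (- k) * ((1 - ln u) powr (- k) * u powr (- (e * k)))) \<le> A"
        unfolding A_def mult.assoc by (intro mult_left_mono) auto
      moreover have "K powr k * K powr (- k) = 1"
        using K by (simp add: powr_add[symmetric])
      ultimately have "(1 - ln u) powr (- k) * u powr (- (e * k)) \<le> A"
        by (simp add: mult.assoc[symmetric])
      then have "(1 - ln u) powr (- k) * u powr (- (e * k)) * u powr (- d - 1) \<le> A * u powr (- d - 1)"
        by (rule mult_right_mono) simp
      moreover have "u powr (- (e * k)) * u powr (- d - 1) = u powr (- r)"
        by (simp add: powr_add[symmetric] d_def)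
      ultimately show ?thesis by (simp add: mult.assoc) (simp add: mult.commute)
    qed
    then have "(\<integral>\<^sup>+u. indicator {x<..<1} u * ennreal (u powr (- r) * (1 - ln u) powr (- k)) \<partial>lborel)
      \<le> (\<integral>\<^sup>+u. ennreal A * (indicator {x<..<1} u * ennreal (u powr (- d - 1))) \<partial>lborel)"
      using A by (intro nn_integral_mono)
        (auto simp: indicator_def ennreal_mult[symmetric] intro!: ennreal_leI)
    also have "\<dots> = ennreal A * (\<integral>\<^sup>+u. indicator {x<..<1} u * ennreal (u powr (- d - 1)) \<partial>lborel)"
      by (simp add: nn_integral_cmult)
    also have "\<dots> \<le> ennreal A * ennreal (x powr (- d) / d)"
      using d x by (intro mult_left_mono nn_integral_powr_1) auto
    also have "\<dots> = ennreal (A * (x powr (- d) / d))"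
      using d A by (simp add: ennreal_mult[symmetric])
    also have "A * (x powr (- d) / d) = K powr k / d * x powr (1 - r) * (1 - ln x) powr (- k)"
    proof -
      have "x powr (- (e * k)) * x powr (- d) = x powr (1 - r)" by (simp add: powr_add[symmetric] d_def)
      then show ?thesis by (simp add: A_def mult_ac)
    qed
    finally show "(\<integral>\<^sup>+u. indicator {x<..<1} u * ennreal (u powr (- r) * (1 - ln u) powr (- k)) \<partial>lborel)
      \<le> ennreal (K powr k / d * x powr (1 - r) * (1 - ln x) powr (- k))" .
  qed (use K d in auto)
qed

section \<open>Decreasing functions on the half-line\<close>

text \<open>Nothing is required at \<open>s \<le> 0\<close>, where a rearrangement may be an infimum of the empty set.\<close>

definition decr :: "(real \<Rightarrow> real) \<Rightarrow> bool" where
  "decr h \<longleftrightarrow> (\<forall>s>0. 0 \<le> h s) \<and> (\<forall>s u. 0 < s \<longrightarrow> s \<le> u \<longrightarrow> h u \<le> h s)"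

definition powint :: "(real \<Rightarrow> real) \<Rightarrow> real \<Rightarrow> real \<Rightarrow> real \<Rightarrow> ennreal" where
  "powint h p a b = (\<integral>\<^sup>+s. indicator {a<..<b} s * ennreal (h s powr p) \<partial>lborel)"

definition lnorm :: "(real \<Rightarrow> real) \<Rightarrow> real \<Rightarrow> real \<Rightarrow> real \<Rightarrow> ennreal" where
  "lnorm h p a b = ennpow (powint h p a b) (1/p)"

text \<open>The endpoint \<open>x\<close> lets one notion serve twice: for a rearrangement
  \<open>x = 1\<close> gives the small norm and \<open>x = \<phi> t\<close> the first term of the
  formula. In the same way \<open>grand_part\<close> is the grand norm at \<open>x = 0\<close> and
  the supremum of the third term at \<open>x = \<phi> t\<close>.\<close>

definition small_part :: "(real \<Rightarrow> real) \<Rightarrow> real \<Rightarrow> real \<Rightarrow> ennreal" where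
  "small_part h p x = (\<integral>\<^sup>+s. indicator {0<..<x} s *
      ennreal ((1 - ln s) powr (-1/p) / s) * lnorm h p 0 s \<partial>lborel)"

definition grand_part :: "(real \<Rightarrow> real) \<Rightarrow> real \<Rightarrow> real \<Rightarrow> ennreal" where
  "grand_part h q x = (SUP s\<in>{x<..<1}. ennreal ((1 - ln s) powr (-1/q)) * lnorm h q s 1)"

lemma decr_nonneg: "decr h \<Longrightarrow> 0 < s \<Longrightarrow> 0 \<le> h s"
  and decr_antimono: "decr h \<Longrightarrow> 0 < s \<Longrightarrow> s \<le> u \<Longrightarrow> h u \<le> h s"
  by (auto simp: decr_def)

text \<open>The indicator discards the half-line on which \<open>decr\<close> says nothing.\<close>

lemma borel_measurable_decr:
  assumes "decr h"
  shows "(\<lambda>s. indicator {0<..} s * h s) \<in> borel_measurable borel"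
proof -
  have "mono_on {0<..} (\<lambda>s. - h s)"
    using assms by (auto simp: mono_on_def decr_def)
  then have "(\<lambda>s. - h s) \<in> borel_measurable (restrict_space borel {0<..})"
    by (rule borel_measurable_mono_on_fnc)
  then have "(\<lambda>s. - (- h s)) \<in> borel_measurable (restrict_space borel {0<..})"
    by (rule borel_measurable_uminus)
  then show ?thesis
    by (subst (asm) borel_measurable_restrict_space_iff) auto
qed

lemma borel_measurable_powint_integrand:
  assumes "decr h" "0 \<le> a"
  shows "(\<lambda>s. indicator {a<..<b} s * ennreal (h s powr p)) \<in> borel_measurable borel"
proof -
  note [measurable] = borel_measurable_decr[OF assms(1)]
  have "(\<lambda>s. indicator {a<..<b} s * ennreal ((indicator {0<..} s * h s) powr p)) \<in> borel_measurable borel"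
    by measurable
  also have "(\<lambda>s. indicator {a<..<b} s * ennreal ((indicator {0<..} s * h s) powr p))
      = (\<lambda>s. indicator {a<..<b} s * ennreal (h s powr p))"
    using assms(2) by (auto simp: indicator_def fun_eq_iff)
  finally show ?thesis .
qed

lemma powint_mono:
  assumes "\<And>s. a < s \<Longrightarrow> s < b \<Longrightarrow> a' < s \<and> s < b' \<and> 0 \<le> h s \<and> h s \<le> k s" "0 \<le> p"
  shows "powint h p a b \<le> powint k p a' b'"
  unfolding powint_def
proof (intro nn_integral_mono)
  fix s
  show "indicator {a<..<b} s * ennreal (h s powr p) \<le> indicator {a'<..<b'} s * ennreal (k s powr p)"
  proof (cases "a < s \<and> s < b")
    case True
    with assms(1)[of s] assms(2) show ?thesis
      by (auto intro!: ennreal_leI powr_mono2)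
  qed auto
qed

lemma powint_subset:
  assumes "a' \<le> a" "b \<le> b'"
  shows "powint h p a b \<le> powint h p a' b'"
  unfolding powint_def using assms
  by (intro nn_integral_mono) (auto simp: indicator_def)

lemma lnorm_mono:
  assumes "\<And>s. a < s \<Longrightarrow> s < b \<Longrightarrow> a' < s \<and> s < b' \<and> 0 \<le> h s \<and> h s \<le> k s" "0 < p"
  shows "lnorm h p a b \<le> lnorm k p a' b'"
  unfolding lnorm_def using assms by (intro ennpow_mono powint_mono) auto

lemma lnorm_subset:
  assumes "a' \<le> a" "b \<le> b'" "0 < p"
  shows "lnorm h p a b \<le> lnorm h p a' b'"
  unfolding lnorm_def using assms by (intro ennpow_mono powint_subset) auto

lemma powint_le_const:
  assumes "\<And>s. a < s \<Longrightarrow> s < b \<Longrightarrow> 0 \<le> h s \<and> h s \<le> l" "0 \<le> p" "a \<le> b"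
  shows "powint h p a b \<le> ennreal (l powr p * (b - a))"
proof -
  have "powint h p a b \<le> powint (\<lambda>_. l) p a b"
    using assms by (intro powint_mono) auto
  also have "\<dots> = (\<integral>\<^sup>+s. ennreal (l powr p) * indicator {a<..<b} s \<partial>lborel)"
    unfolding powint_def by (simp add: mult.commute)
  also have "\<dots> = ennreal (l powr p * (b - a))"
    using assms by (subst nn_integral_cmult_indicator) (auto simp: ennreal_mult)
  finally show ?thesis .
qed

lemma const_le_powint:
  assumes "\<And>s. a < s \<Longrightarrow> s < b \<Longrightarrow> l \<le> h s" "0 \<le> l" "0 \<le> p" "a \<le> b"
  shows "ennreal (l powr p * (b - a)) \<le> powint h p a b"
proof -
  have "ennreal (l powr p * (b - a)) = (\<integral>\<^sup>+s. ennreal (l powr p) * indicator {a<..<b} s \<partial>lborel)"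
    using assms by (subst nn_integral_cmult_indicator) (auto simp: ennreal_mult)
  also have "\<dots> = powint (\<lambda>_. l) p a b"
    unfolding powint_def by (simp add: mult.commute)
  also have "\<dots> \<le> powint h p a b"
    using assms by (intro powint_mono) auto
  finally show ?thesis .
qed

lemma const_le_lnorm:
  assumes "\<And>s. a < s \<Longrightarrow> s < b \<Longrightarrow> l \<le> h s" "0 \<le> l" "0 < p" "a \<le> b"
  shows "ennreal (l * (b - a) powr (1/p)) \<le> lnorm h p a b"
proof -
  have "ennreal (l * (b - a) powr (1/p)) = ennpow (ennreal (l powr p * (b - a))) (1/p)"
    using assms by (simp add: powr_mult powr_powr)
  also have "\<dots> \<le> lnorm h p a b"
    unfolding lnorm_def using assms by (intro ennpow_mono const_le_powint) auto
  finally show ?thesis .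
qed

lemma powint_split:
  assumes "decr h" "0 \<le> a" "a \<le> b" "b \<le> c"
  shows "powint h p a c \<le> powint h p a b + powint h p b c"
proof -
  have [measurable]: "(\<lambda>s. indicator {x<..<y} s * ennreal (h s powr p)) \<in> borel_measurable borel"
    if "0 \<le> x" for x y
    using borel_measurable_powint_integrand[OF assms(1) that] .
  have "powint h p a c \<le> (\<integral>\<^sup>+s. indicator {a<..<b} s * ennreal (h s powr p)
      + indicator {b<..<c} s * ennreal (h s powr p) \<partial>lborel)"
    unfolding powint_def
  proof (intro nn_integral_mono_AE)
    show "AE s in lborel. indicator {a<..<c} s * ennreal (h s powr p)
      \<le> indicator {a<..<b} s * ennreal (h s powr p) + indicator {b<..<c} s * ennreal (h s powr p)"
      using AE_lborel_singleton[of b] by eventually_elim (auto simp: indicator_def)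
  qed
  also have "\<dots> = powint h p a b + powint h p b c"
    unfolding powint_def using assms by (intro nn_integral_add) auto
  finally show ?thesis .
qed

section \<open>Halving the argument and adding\<close>

lemma powint_dilation:
  assumes "decr h" "0 \<le> a"
  shows "powint (\<lambda>s. h (s / 2)) p a b = 2 * powint h p (a / 2) (b / 2)"
proof -
  have "(\<lambda>s. indicator {a/2<..<b/2} s * ennreal (h s powr p)) \<in> borel_measurable borel"
    using assms by (intro borel_measurable_powint_integrand) auto
  from nn_integral_real_affine[OF this, of "1/2" 0]
  have "2 * powint h p (a / 2) (b / 2) = 2 * (ennreal (1/2) * (\<integral>\<^sup>+x. indicator {a/2<..<b/2} (x/2) * ennreal (h (x/2) powr p) \<partial>lborel))"
    unfolding powint_def by simp
  also have "\<dots> = (\<integral>\<^sup>+x. indicator {a/2<..<b/2} (x/2) * ennreal (h (x/2) powr p) \<partial>lborel)"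
  proof -
    have "2 * ennreal (1/2) = 1"
      by (metis ennreal_1 ennreal_mult' ennreal_numeral mult_2 field_sum_of_halves zero_le_numeral)
    then show ?thesis by (simp add: mult.assoc[symmetric])
  qed
  also have "\<dots> = powint (\<lambda>s. h (s / 2)) p a b"
    unfolding powint_def by (intro nn_integral_cong) (auto simp: indicator_def)
  finally show ?thesis by simp
qed

lemma decr_dilation: "decr h \<Longrightarrow> decr (\<lambda>s. h (s / 2))"
  by (auto simp: decr_def)

lemma powint_add_le:
  assumes "decr h" "decr k" "0 \<le> a" "0 \<le> p"
    and "\<And>s. a < s \<Longrightarrow> s < b \<Longrightarrow> 0 \<le> F s \<and> F s \<le> h s + k s"
  shows "powint F p a b \<le> ennreal (2 powr p) * (powint h p a b + powint k p a b)"
proof -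
  note [measurable] = borel_measurable_powint_integrand[OF assms(1,3)] borel_measurable_powint_integrand[OF assms(2,3)]
  have "powint F p a b \<le> (\<integral>\<^sup>+s. ennreal (2 powr p) * (indicator {a<..<b} s * ennreal (h s powr p)
      + indicator {a<..<b} s * ennreal (k s powr p)) \<partial>lborel)"
    unfolding powint_def
  proof (intro nn_integral_mono)
    fix s
    show "indicator {a<..<b} s * ennreal (F s powr p) \<le> ennreal (2 powr p) *
      (indicator {a<..<b} s * ennreal (h s powr p) + indicator {a<..<b} s * ennreal (k s powr p))"
    proof (cases "a < s \<and> s < b")
      case True
      then have "F s powr p \<le> (h s + k s) powr p"
        using assms(4,5) by (intro powr_mono2) auto
      also have "\<dots> \<le> 2 powr p * (h s powr p + k s powr p)"
        using True assms(3,4) decr_nonneg[OF assms(1)] decr_nonneg[OF assms(2)]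
        by (intro powr_add_le) auto
      finally show ?thesis
        using True by (simp add: ennreal_plus[symmetric] ennreal_mult[symmetric] ennreal_leI del: ennreal_plus)
    qed auto
  qed
  also have "\<dots> = ennreal (2 powr p) * (powint h p a b + powint k p a b)"
    unfolding powint_def by (simp add: nn_integral_cmult nn_integral_add)
  finally show ?thesis .
qed

text \<open>The constant collects three factors: 2 from adding \<open>p\<close>-th powers,
  \<open>2 powr (1/p)\<close> from the dilation and \<open>2 powr (1/p)\<close> from taking the root
  of a sum. Their product is at most \<open>2 powr 3\<close>.\<close>

lemma lnorm_add_dilation_le:
  assumes "decr h" "decr k" "0 \<le> a" "1 \<le> p"
    and "\<And>s. a < s \<Longrightarrow> s < b \<Longrightarrow> 0 \<le> F s \<and> F s \<le> h (s / 2) + k (s / 2)"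
  shows "lnorm F p a b \<le> 8 * (lnorm h p (a/2) (b/2) + lnorm k p (a/2) (b/2))"
proof -
  have p: "0 < p" using assms by simp
  have "powint F p a b \<le> ennreal (2 powr p) * (2 * powint h p (a/2) (b/2) + 2 * powint k p (a/2) (b/2))"
    using powint_add_le[OF decr_dilation[OF assms(1)] decr_dilation[OF assms(2)] assms(3) _ assms(5)] p
    by (simp add: powint_dilation[OF assms(1,3)] powint_dilation[OF assms(2,3)])
  also have "\<dots> = ennreal (2 powr p * 2) * (powint h p (a/2) (b/2) + powint k p (a/2) (b/2))"
    by (simp add: ennreal_mult distrib_left mult.assoc)
  finally have "lnorm F p a b \<le> ennpow (ennreal (2 powr p * 2) * (powint h p (a/2) (b/2) + powint k p (a/2) (b/2))) (1/p)"
    unfolding lnorm_def using p by (intro ennpow_mono) auto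
  also have "\<dots> = ennreal ((2 powr p * 2) powr (1/p)) * ennpow (powint h p (a/2) (b/2) + powint k p (a/2) (b/2)) (1/p)"
    by (intro ennpow_cmult) simp
  also have "\<dots> \<le> ennreal ((2 powr p * 2) powr (1/p)) *
      (ennreal (2 powr (1/p)) * (lnorm h p (a/2) (b/2) + lnorm k p (a/2) (b/2)))"
    unfolding lnorm_def using p by (intro mult_left_mono ennpow_add_le) auto
  also have "\<dots> = ennreal ((2 powr p * 2) powr (1/p) * 2 powr (1/p)) *
      (lnorm h p (a/2) (b/2) + lnorm k p (a/2) (b/2))"
    by (simp add: ennreal_mult mult.assoc)
  also have "\<dots> \<le> ennreal 8 * (lnorm h p (a/2) (b/2) + lnorm k p (a/2) (b/2))"
  proof (intro mult_right_mono ennreal_leI)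
    have "(2 powr p * 2) powr (1/p) * 2 powr (1/p) = 2 powr (1 + 1/p + 1/p :: real)"
      using p by (simp only: powr_add) (simp add: powr_mult powr_powr)
    also have "\<dots> \<le> 2 powr (3::real)"
      using assms(4) by (intro powr_mono) (auto simp: field_simps)
    finally show "(2 powr p * 2) powr (1/p) * 2 powr (1/p) \<le> (8::real)"
      by simp
  qed auto
  finally show ?thesis by simp
qed

lemma borel_measurable_lnorm_0:
  assumes "0 < p"
  shows "(\<lambda>s. lnorm h p 0 s) \<in> borel_measurable borel"
  using assms by (intro borel_measurable_ennreal_mono monoI lnorm_subset) auto

lemma borel_measurable_small_integrand:
  assumes "0 < p"
  shows "(\<lambda>s. indicator {0<..<x} s * ennreal ((1 - ln s) powr r / s) * lnorm h p 0 s)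
    \<in> borel_measurable borel"
  using borel_measurable_lnorm_0[OF assms, measurable] by measurable

section \<open>What bounds on the grand and the small norm say about a decreasing function\<close>

lemma ennreal_le_divideI:
  assumes "0 < c" "0 \<le> m" "ennreal c * X \<le> ennreal m"
  shows "X \<le> ennreal (m / c)"
proof (cases X)
  case (real r)
  with assms show ?thesis
    by (simp add: ennreal_mult[symmetric] field_simps)
next
  case top
  with assms show ?thesis by (simp add: ennreal_mult_top top_unique)
qed

lemma one_minus_ln_half:
  fixes u :: real
  assumes "0 < u" "u \<le> 1"
  shows "1 - ln u \<le> 1 - ln (u / 2)" "1 - ln (u / 2) \<le> 2 * (1 - ln u)" "1 \<le> 1 - ln u"
proof -
  have half: "ln (u / 2) = ln u - ln 2" using assms by (simp add: ln_div)
  have ln2: "ln 2 \<le> (1::real)" "0 \<le> ln (2::real)" using ln_2_less_1 by auto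
  have u: "ln u \<le> 0" using assms by simp
  show "1 - ln u \<le> 1 - ln (u / 2)" using half ln2 by linarith
  show "1 - ln (u / 2) \<le> 2 * (1 - ln u)" using half ln2 u by argo
  show "1 \<le> 1 - ln u" using u by linarith
qed

text \<open>On (u/2, u) the function is at least \<open>h u\<close>, so the supremum, tested at
  \<open>u / 2\<close>, already contains \<open>h u * (u / 2) powr (1/q)\<close>. The 4 bounds two
  factors \<open>2 powr (1/q)\<close>, one from the logarithm at \<open>u / 2\<close> and one from
  the power of \<open>u / 2\<close>.\<close>

lemma grand_pointwise:
  assumes "decr h" "1 < q" "0 \<le> n" "grand_part h q 0 \<le> ennreal n" "0 < u" "u < 1"
  shows "h u \<le> 4 * n * (1 - ln u) powr (1/q) * u powr (-1/q)"
proof -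
  define l where "l = 1 - ln (u / 2)"
  have l: "l \<le> 2 * (1 - ln u)" "1 \<le> l" "1 \<le> 1 - ln u"
    using one_minus_ln_half[of u] assms by (auto simp: l_def)
  have hu: "0 \<le> h u" using decr_nonneg assms by blast
  have "ennreal (l powr (-1/q) * (h u * (u - u / 2) powr (1/q))) \<le> ennreal (l powr (-1/q)) * lnorm h q (u / 2) u"
    using assms hu const_le_lnorm[of "u/2" u "h u" h q] decr_antimono[OF assms(1)]
    by (subst ennreal_mult) (auto intro!: mult_left_mono)
  also have "\<dots> \<le> ennreal (l powr (-1/q)) * lnorm h q (u / 2) 1"
    using assms by (intro mult_left_mono lnorm_subset) auto
  also have "\<dots> \<le> grand_part h q 0"
    unfolding grand_part_def l_def using assms by (intro SUP_upper) auto
  also have "\<dots> \<le> ennreal n" by fact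
  finally have "l powr (-1/q) * (h u * (u / 2) powr (1/q)) \<le> n"
    using assms by simp
  then have "l powr (1/q) * (u / 2) powr (-1/q) * (l powr (-1/q) * (h u * (u / 2) powr (1/q)))
      \<le> l powr (1/q) * (u / 2) powr (-1/q) * n"
    by (intro mult_left_mono) auto
  moreover have "l powr (1/q) * l powr (-1/q) = 1" "(u / 2) powr (-1/q) * (u / 2) powr (1/q) = 1"
    using l assms by (simp_all add: powr_add[symmetric])
  ultimately have "h u \<le> l powr (1/q) * ((u / 2) powr (-1/q) * n)"
    by (metis (no_types, opaque_lifting) mult.assoc mult.left_commute mult.right_neutral)
  also have "\<dots> \<le> (2 * (1 - ln u)) powr (1/q) * ((u / 2) powr (-1/q) * n)"
    using l assms by (intro mult_right_mono powr_mono2) auto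
  also have "(2 * (1 - ln u)) powr (1/q) = 2 powr (1/q) * (1 - ln u) powr (1/q)"
    using l by (subst powr_mult) auto
  also have "(u / 2) powr (-1/q) = 2 powr (1/q) * u powr (-1/q)"
    using assms by (simp add: powr_divide powr_minus_divide)
  also have "2 powr (1/q) * (1 - ln u) powr (1/q) * (2 powr (1/q) * u powr (-1/q) * n)
      = (2 powr (1/q) * 2 powr (1/q)) * ((1 - ln u) powr (1/q) * u powr (-1/q) * n)"
    by (simp add: mult_ac)
  also have "\<dots> \<le> (2 * 2) * ((1 - ln u) powr (1/q) * u powr (-1/q) * n)"
  proof -
    have "2 powr (1/q) \<le> 2 powr (1::real)"
      using assms by (intro powr_mono) auto
    then show ?thesis using assms by (intro mult_right_mono mult_mono) auto
  qed
  finally show ?thesis by (simp add: mult_ac)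
qed

text \<open>The \<open>p\<close>-th power of the pointwise bound has the singularity
  \<open>u powr (- (p/q))\<close>, which is integrable at 0 because \<open>p < q\<close>. The
  quantifiers are ordered so that \<open>C\<close> depends on \<open>p\<close> and \<open>q\<close>
  alone.\<close>

lemma lnorm_le_grand:
  assumes "1 < p" "p < q"
  shows "\<exists>C>0. \<forall>h n x. decr h \<and> 0 \<le> n \<and> grand_part h q 0 \<le> ennreal n \<and> 0 < x \<and> x \<le> 1 \<longrightarrow>
    lnorm h p 0 x \<le> ennreal (C * n * x powr (1/p - 1/q) * (1 - ln x) powr (1/q))"
proof -
  obtain C where C: "C > 0" "\<And>x. 0 < x \<Longrightarrow> x \<le> 1 \<Longrightarrow>
    (\<integral>\<^sup>+u. indicator {0<..<x} u * ennreal (u powr (- (p/q)) * (1 - ln u) powr (p/q)) \<partial>lborel)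
      \<le> ennreal (C * x powr (1 - p/q) * (1 - ln x) powr (p/q))"
    using nn_integral_powr_log_0[of "p/q"] assms by auto
  show ?thesis
  proof (intro exI[of _ "4 * C powr (1/p)"] conjI allI impI)
    fix h n and x :: real
    assume A: "decr h \<and> 0 \<le> n \<and> grand_part h q 0 \<le> ennreal n \<and> 0 < x \<and> x \<le> 1"
    have le: "h u powr p \<le> (4 * n) powr p * (u powr (- (p/q)) * (1 - ln u) powr (p/q))" if "0 < u" "u < x" for u
    proof -
      have "h u powr p \<le> (4 * n * (1 - ln u) powr (1/q) * u powr (-1/q)) powr p"
        using that A assms grand_pointwise[of h q n u] decr_nonneg[of h u]
        by (intro powr_mono2) auto
      also have "\<dots> = (4 * n) powr p * (u powr (- (p/q)) * (1 - ln u) powr (p/q))"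
        using A by (simp add: powr_mult powr_powr mult_ac)
      finally show ?thesis .
    qed
    have "powint h p 0 x \<le> (\<integral>\<^sup>+u. ennreal ((4 * n) powr p) *
        (indicator {0<..<x} u * ennreal (u powr (- (p/q)) * (1 - ln u) powr (p/q))) \<partial>lborel)"
      unfolding powint_def using le
      by (intro nn_integral_mono) (auto simp: indicator_def ennreal_mult[symmetric] intro!: ennreal_leI)
    also have "\<dots> = ennreal ((4 * n) powr p) *
        (\<integral>\<^sup>+u. indicator {0<..<x} u * ennreal (u powr (- (p/q)) * (1 - ln u) powr (p/q)) \<partial>lborel)"
      by (intro nn_integral_cmult) measurable
    also have "\<dots> \<le> ennreal ((4 * n) powr p) * ennreal (C * x powr (1 - p/q) * (1 - ln x) powr (p/q))"
      using A by (intro mult_left_mono C) auto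
    also have "\<dots> = ennreal ((4 * n) powr p * (C * x powr (1 - p/q) * (1 - ln x) powr (p/q)))"
      using A C by (simp add: ennreal_mult[symmetric])
    finally have "lnorm h p 0 x \<le> ennpow \<dots> (1/p)"
      unfolding lnorm_def using assms by (intro ennpow_mono) auto
    also have "\<dots> = ennreal (4 * C powr (1/p) * n * x powr (1/p - 1/q) * (1 - ln x) powr (1/q))"
    proof -
      have "(1 - p/q) * (1/p) = 1/p - 1/q" using assms by (simp add: field_simps)
      then have "((4 * n) powr p * (C * x powr (1 - p/q) * (1 - ln x) powr (p/q))) powr (1/p)
          = 4 * C powr (1/p) * n * x powr (1/p - 1/q) * (1 - ln x) powr (1/q)"
        using A C assms by (simp add: powr_mult powr_powr mult_ac)
      then show ?thesis using A C by simp
    qed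
    finally show "lnorm h p 0 x \<le> ennreal (4 * C powr (1/p) * n * x powr (1/p - 1/q) * (1 - ln x) powr (1/q))" .
  qed (use C in auto)
qed

text \<open>As \<open>lnorm h p 0 u\<close> increases with \<open>u\<close>, its value at
  \<open>x\<close> can be pulled out of the small norm over (x, 1), leaving a weight of at least
  \<open>(1 - ln x) powr (-1/p) * - ln x\<close>. The bound \<open>x \<le> 1/2\<close> keeps
  \<open>- ln x\<close> away from 0: it gives \<open>ln x \<le> - (1/2)\<close>, that is
  \<open>1 - ln x \<le> 3 * - ln x\<close>, whence the 3.\<close>

lemma lnorm_le_small:
  assumes "1 < p" "0 \<le> m" "small_part h p 1 \<le> ennreal m" "0 < x" "x \<le> 1/2"
  shows "lnorm h p 0 x \<le> ennreal (3 * m * (1 - ln x) powr (1/p - 1))"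
proof -
  define l where "l = 1 - ln x"
  have "ln x \<le> ln (1/2)" using assms by (subst ln_le_cancel_iff) auto
  also have "\<dots> \<le> - (1/2)" using ln_le_minus_one[of "1/2::real"] by simp
  finally have lx: "ln x \<le> - (1/2)" .
  then have l: "1 \<le> l" "l / 3 \<le> - ln x" by (auto simp: l_def)
  have x: "0 < x" "x \<le> 1" using assms by auto
  have e: "ennreal (l powr (-1/p) * - ln x) = ennreal (l powr (-1/p)) * ennreal (- ln x)"
    using lx by (intro ennreal_mult) auto
  have "ennreal (l powr (-1/p) * - ln x) * lnorm h p 0 x
      = ennreal (l powr (-1/p)) * lnorm h p 0 x * (\<integral>\<^sup>+u. indicator {x<..<1} u * ennreal (1/u) \<partial>lborel)"
    unfolding e nn_integral_inverse[OF x] by (simp only: mult_ac)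
  also have "\<dots> = (\<integral>\<^sup>+u. ennreal (l powr (-1/p)) * lnorm h p 0 x * (indicator {x<..<1} u * ennreal (1/u)) \<partial>lborel)"
    by (intro nn_integral_cmult[symmetric]) measurable
  also have "\<dots> \<le> small_part h p 1"
    unfolding small_part_def
  proof (intro nn_integral_mono)
    fix u
    show "ennreal (l powr (-1/p)) * lnorm h p 0 x * (indicator {x<..<1} u * ennreal (1/u))
      \<le> indicator {0<..<1} u * ennreal ((1 - ln u) powr (-1/p) / u) * lnorm h p 0 u"
    proof (cases "x < u \<and> u < 1")
      case True
      with assms have u: "0 < u" "u < 1" by auto
      have "l powr (-1/p) \<le> (1 - ln u) powr (-1/p)"
        using True assms u ln_less_one[of u] by (intro powr_mono2') (auto simp: l_def)
      then have "ennreal (l powr (-1/p) * (1/u)) * lnorm h p 0 x \<le> ennreal ((1 - ln u) powr (-1/p) * (1/u)) * lnorm h p 0 u"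
        using True assms u by (intro mult_mono ennreal_leI mult_right_mono lnorm_subset) auto
      moreover have "ennreal (l powr (-1/p) * (1/u)) = ennreal (l powr (-1/p)) * ennreal (1/u)"
        using u by (intro ennreal_mult) auto
      ultimately show ?thesis
        using True u by (simp add: mult_ac)
    qed auto
  qed
  also have "\<dots> \<le> ennreal m" by fact
  finally have "ennreal (l powr (-1/p) * - ln x) * lnorm h p 0 x \<le> ennreal m" .
  then have "lnorm h p 0 x \<le> ennreal (m / (l powr (-1/p) * - ln x))"
    using l lx assms by (intro ennreal_le_divideI mult_pos_pos) auto
  also have "m / (l powr (-1/p) * - ln x) \<le> m / (l powr (-1/p) * (l / 3))"
    using l lx assms by (intro divide_left_mono mult_left_mono mult_pos_pos) auto
  also have "l powr (-1/p) * (l / 3) = l powr (1 - 1/p) / 3"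
    using l by (simp add: powr_diff powr_minus_divide)
  also have "m / (l powr (1 - 1/p) / 3) = 3 * m * l powr (1/p - 1)"
    using l by (simp add: powr_diff)
  finally show ?thesis by (simp add: l_def ennreal_leI)
qed

text \<open>Monotonicity gives \<open>h u * u powr (1/p) \<le> lnorm h p 0 u\<close>, so the
  preceding estimate becomes a pointwise one. In its \<open>q\<close>-th power \<open>u\<close> has
  the exponent \<open>- (q/p)\<close>, below -1, and the tail is governed by its left end. The limit
  1/2 is both the range of that estimate and the image of 1 under halving.\<close>

lemma lnorm_tail_le_small:
  assumes "1 < p" "p < q"
  shows "\<exists>C>0. \<forall>h m x. decr h \<and> 0 \<le> m \<and> small_part h p 1 \<le> ennreal m \<and> 0 < x \<and> x \<le> 1 \<longrightarrow>
    lnorm h q x (1/2) \<le> ennreal (C * m * x powr (1/q - 1/p) * (1 - ln x) powr (1/p - 1))"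
proof -
  define k where "k = q * (1 - 1/p)"
  have k: "0 < k" using assms by (simp add: k_def)
  obtain C where C: "C > 0" "\<And>x. 0 < x \<Longrightarrow> x \<le> 1 \<Longrightarrow>
    (\<integral>\<^sup>+u. indicator {x<..<1} u * ennreal (u powr (- (q/p)) * (1 - ln u) powr (- k)) \<partial>lborel)
      \<le> ennreal (C * x powr (1 - q/p) * (1 - ln x) powr (- k))"
    using nn_integral_powr_log_1[of "q/p" k] assms k by auto
  show ?thesis
  proof (intro exI[of _ "3 * C powr (1/q)"] conjI allI impI)
    fix h m and x :: real
    assume A: "decr h \<and> 0 \<le> m \<and> small_part h p 1 \<le> ennreal m \<and> 0 < x \<and> x \<le> 1"
    have le: "h u powr q \<le> (3 * m) powr q * (u powr (- (q/p)) * (1 - ln u) powr (- k))" if "x < u" "u < 1/2" for u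
    proof -
      have u: "0 < u" "u \<le> 1/2" using that A by auto
      have hu: "0 \<le> h u" using A u decr_nonneg by blast
      have "ennreal (h u * (u - 0) powr (1/p)) \<le> lnorm h p 0 u"
        using A u hu assms decr_antimono[of h _ u] by (intro const_le_lnorm) auto
      also have "\<dots> \<le> ennreal (3 * m * (1 - ln u) powr (1/p - 1))"
        using A u assms by (intro lnorm_le_small) auto
      finally have "h u * u powr (1/p) \<le> 3 * m * (1 - ln u) powr (1/p - 1)"
        using A by simp
      then have "(h u * u powr (1/p)) powr q \<le> (3 * m * (1 - ln u) powr (1/p - 1)) powr q"
        using hu assms by (intro powr_mono2) auto
      then have "h u powr q * u powr (q/p) \<le> (3 * m) powr q * (1 - ln u) powr (- k)"
        using hu A by (simp add: powr_mult powr_powr k_def algebra_simps)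
      then have "h u powr q * u powr (q/p) * u powr (- (q/p)) \<le> (3 * m) powr q * (1 - ln u) powr (- k) * u powr (- (q/p))"
        by (rule mult_right_mono) simp
      moreover have "u powr (q/p) * u powr (- (q/p)) = 1"
        using u by (simp add: powr_add[symmetric])
      ultimately show ?thesis by (simp add: mult.assoc) (simp add: mult_ac)
    qed
    have "powint h q x (1/2) \<le> (\<integral>\<^sup>+u. ennreal ((3 * m) powr q) *
        (indicator {x<..<1} u * ennreal (u powr (- (q/p)) * (1 - ln u) powr (- k))) \<partial>lborel)"
      unfolding powint_def using le
      by (intro nn_integral_mono) (auto simp: indicator_def ennreal_mult[symmetric] intro!: ennreal_leI)
    also have "\<dots> = ennreal ((3 * m) powr q) *
        (\<integral>\<^sup>+u. indicator {x<..<1} u * ennreal (u powr (- (q/p)) * (1 - ln u) powr (- k)) \<partial>lborel)"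
      by (intro nn_integral_cmult) measurable
    also have "\<dots> \<le> ennreal ((3 * m) powr q) * ennreal (C * x powr (1 - q/p) * (1 - ln x) powr (- k))"
      using A by (intro mult_left_mono C) auto
    also have "\<dots> = ennreal ((3 * m) powr q * (C * x powr (1 - q/p) * (1 - ln x) powr (- k)))"
      using A C by (simp add: ennreal_mult[symmetric])
    finally have "lnorm h q x (1/2) \<le> ennpow \<dots> (1/q)"
      unfolding lnorm_def using assms by (intro ennpow_mono) auto
    also have "\<dots> = ennreal (3 * C powr (1/q) * m * x powr (1/q - 1/p) * (1 - ln x) powr (1/p - 1))"
    proof -
      have "(1 - q/p) * (1/q) = 1/q - 1/p" "- k * (1/q) = 1/p - 1"
        using assms by (simp_all add: field_simps k_def)
      then have "((3 * m) powr q * (C * x powr (1 - q/p) * (1 - ln x) powr (- k))) powr (1/q)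
          = 3 * C powr (1/q) * m * x powr (1/q - 1/p) * (1 - ln x) powr (1/p - 1)"
        using A C assms by (simp add: powr_mult powr_powr mult_ac)
      then show ?thesis using A C by simp
    qed
    finally show "lnorm h q x (1/2) \<le> ennreal (3 * C powr (1/q) * m * x powr (1/q - 1/p) * (1 - ln x) powr (1/p - 1))" .
  qed (use C in auto)
qed

text \<open>The halved interval (0, s/2) is enlarged back to (0, s), so the weight in
  \<open>s\<close> needs no change of variables.\<close>

lemma small_part_add_dilation_le:
  assumes "decr h" "decr k" "1 \<le> p" "x \<le> 1"
    and "\<And>s. 0 < s \<Longrightarrow> s < 1 \<Longrightarrow> 0 \<le> F s \<and> F s \<le> h (s / 2) + k (s / 2)"
  shows "small_part F p x \<le> 8 * (small_part h p x + small_part k p x)"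
proof -
  let ?w = "\<lambda>h s. indicator {0<..<x} s * ennreal ((1 - ln s) powr (-1/p) / s) * lnorm h p 0 s"
  have [measurable]: "?w h \<in> borel_measurable borel" for h
    using borel_measurable_small_integrand[of p] assms by simp
  have "small_part F p x \<le> (\<integral>\<^sup>+s. 8 * (?w h s + ?w k s) \<partial>lborel)"
    unfolding small_part_def
  proof (intro nn_integral_mono)
    fix s
    show "?w F s \<le> 8 * (?w h s + ?w k s)"
    proof (cases "0 < s \<and> s < x")
      case True
      have "lnorm F p 0 s \<le> 8 * (lnorm h p (0/2) (s/2) + lnorm k p (0/2) (s/2))"
        using True assms by (intro lnorm_add_dilation_le) auto
      also have "\<dots> \<le> 8 * (lnorm h p 0 s + lnorm k p 0 s)"
        using True assms by (intro mult_left_mono add_mono lnorm_subset) auto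
      finally have "?w F s \<le> indicator {0<..<x} s * ennreal ((1 - ln s) powr (-1/p) / s) * (8 * (lnorm h p 0 s + lnorm k p 0 s))"
        by (rule mult_left_mono) simp
      then show ?thesis by (simp add: algebra_simps)
    qed auto
  qed
  also have "\<dots> = 8 * (\<integral>\<^sup>+s. ?w h s + ?w k s \<partial>lborel)"
    by (intro nn_integral_cmult) measurable
  also have "(\<integral>\<^sup>+s. ?w h s + ?w k s \<partial>lborel) = small_part h p x + small_part k p x"
    unfolding small_part_def by (intro nn_integral_add) measurable
  finally show ?thesis .
qed

text \<open>The weight and the logarithm from the bound on \<open>lnorm h p 0 s\<close> multiply to
  \<open>(1 - ln s) powr (- \<alpha>)\<close>, which is at most 1; only the integral of
  \<open>s powr (\<alpha> - 1)\<close> remains.\<close>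

lemma small_part_le_grand:
  assumes "1 < p" "p < q"
  shows "\<exists>C>0. \<forall>h n x. decr h \<and> 0 \<le> n \<and> grand_part h q 0 \<le> ennreal n \<and> 0 < x \<and> x \<le> 1 \<longrightarrow>
    small_part h p x \<le> ennreal (C * n * x powr (1/p - 1/q))"
proof -
  define \<alpha> where "\<alpha> = 1/p - 1/q"
  have \<alpha>: "0 < \<alpha>" using assms by (simp add: \<alpha>_def field_simps)
  obtain C where C: "C > 0" "\<And>h n x. decr h \<and> 0 \<le> n \<and> grand_part h q 0 \<le> ennreal n \<and> 0 < x \<and> x \<le> 1 \<Longrightarrow>
    lnorm h p 0 x \<le> ennreal (C * n * x powr \<alpha> * (1 - ln x) powr (1/q))"
    using lnorm_le_grand[OF assms] unfolding \<alpha>_def by blast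
  show ?thesis
  proof (intro exI[of _ "C / \<alpha>"] conjI allI impI)
    fix h n and x :: real
    assume A: "decr h \<and> 0 \<le> n \<and> grand_part h q 0 \<le> ennreal n \<and> 0 < x \<and> x \<le> 1"
    have "small_part h p x \<le> (\<integral>\<^sup>+s. ennreal (C * n) * (indicator {0<..<x} s * ennreal (s powr (\<alpha> - 1))) \<partial>lborel)"
      unfolding small_part_def
    proof (intro nn_integral_mono)
      fix s
      show "indicator {0<..<x} s * ennreal ((1 - ln s) powr (-1/p) / s) * lnorm h p 0 s
        \<le> ennreal (C * n) * (indicator {0<..<x} s * ennreal (s powr (\<alpha> - 1)))"
      proof (cases "0 < s \<and> s < x")
        case True
        define l where "l = 1 - ln s"
        have l: "1 \<le> l" using True A by (simp add: l_def)
        have "ennreal (l powr (-1/p) / s) * lnorm h p 0 s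
            \<le> ennreal (l powr (-1/p) / s) * ennreal (C * n * s powr \<alpha> * l powr (1/q))"
          unfolding l_def using True A by (intro mult_left_mono C(2)) auto
        also have "\<dots> = ennreal (C * n * (s powr \<alpha> / s) * (l powr (-1/p) * l powr (1/q)))"
          using True A C by (subst ennreal_mult[symmetric]) (auto simp: mult_ac)
        also have "\<dots> \<le> ennreal (C * n * (s powr \<alpha> / s) * 1)"
        proof (intro ennreal_leI mult_left_mono)
          have "l powr (-1/p) * l powr (1/q) = l powr (- \<alpha>)"
            using l by (simp add: powr_add[symmetric] \<alpha>_def)
          also have "\<dots> \<le> l powr 0" using l \<alpha> by (intro powr_mono) auto
          finally show "l powr (-1/p) * l powr (1/q) \<le> 1" using l by simp
        qed (use True A C in auto)
        also have "s powr \<alpha> / s = s powr (\<alpha> - 1)" using True by (simp add: powr_diff)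
        finally show ?thesis
          using True A C by (simp add: l_def ennreal_mult)
      qed auto
    qed
    also have "\<dots> = ennreal (C * n) * ennreal (x powr \<alpha> / \<alpha>)"
      using A \<alpha> by (simp add: nn_integral_cmult nn_integral_powr_0)
    also have "\<dots> = ennreal (C / \<alpha> * n * x powr (1/p - 1/q))"
      using A C \<alpha> by (simp add: ennreal_mult[symmetric] \<alpha>_def[symmetric])
    finally show "small_part h p x \<le> ennreal (C / \<alpha> * n * x powr (1/p - 1/q))" .
  qed (use C \<alpha> in auto)
qed

section \<open>The K-functional for decreasing functions\<close>

text \<open>Everything the estimates use about \<phi>, at a single \<open>t\<close>. The bound of
  \<open>t\<close> is required at every \<open>s\<close> beyond \<phi> because its right-hand side
  need not be monotone near 1. The last two conditions make the weights \<open>1 - ln t\<close> and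
  \<open>1 - ln \<phi>\<close> interchangeable.\<close>

definition cut_point :: "real \<Rightarrow> real \<Rightarrow> real \<Rightarrow> real \<Rightarrow> real \<Rightarrow> bool" where
  "cut_point p q c \<phi> t \<longleftrightarrow> 0 < \<phi> \<and> \<phi> < 1 \<and> 0 < t \<and> t < 1 \<and> 1 \<le> c \<and>
     \<phi> powr (1/p - 1/q) * (1 - ln \<phi>) powr (1 - (1/p - 1/q)) \<le> c * t \<and>
     (\<forall>s. \<phi> \<le> s \<and> s < 1 \<longrightarrow> t \<le> s powr (1/p - 1/q) * (1 - ln s) powr (1 - (1/p - 1/q))) \<and>
     1 - ln t \<le> 1 - ln \<phi> \<and> 1 - ln \<phi> \<le> c * (1 - ln t)"

definition Kterm :: "(real \<Rightarrow> real) \<Rightarrow> real \<Rightarrow> real \<Rightarrow> real \<Rightarrow> real \<Rightarrow> ennreal" where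
  "Kterm h p q \<phi> t = small_part h p \<phi> + ennreal ((1 - ln t) powr ((p - 1) / p)) * lnorm h p 0 \<phi>
     + ennreal t * grand_part h q \<phi>"

lemma small_part_mono: "x \<le> y \<Longrightarrow> small_part h p x \<le> small_part h p y"
  unfolding small_part_def by (intro nn_integral_mono) (auto simp: indicator_def)

lemma numeral_mult_ennreal_add:
  "0 \<le> x \<Longrightarrow> 0 \<le> y \<Longrightarrow> numeral w * (ennreal x + ennreal y) = ennreal (numeral w * (x + y))"
  by (simp add: ennreal_mult distrib_left)

text \<open>Here \<open>h\<close> and \<open>k\<close> stand for the rearrangements of the two
  summands of an arbitrary decomposition. Each of the three terms splits into a part from
  \<open>h\<close>, bounded by a multiple of the small norm \<open>m\<close>, and a part from
  \<open>k\<close>, bounded by a multiple of \<open>t * n\<close> with \<open>n\<close> the grand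
  norm.\<close>

lemma Kterm_lower:
  assumes pq: "1 < p" "p < q" and c: "1 \<le> c"
  shows "\<exists>C>0. \<forall>F h k \<phi> t. cut_point p q c \<phi> t \<and> decr h \<and> decr k \<and>
      (\<forall>s. 0 < s \<and> s < 1 \<longrightarrow> 0 \<le> F s \<and> F s \<le> h (s / 2) + k (s / 2)) \<longrightarrow>
    Kterm F p q \<phi> t \<le> ennreal C * (small_part h p 1 + ennreal t * grand_part k q 0)"
proof -
  define \<alpha> where "\<alpha> = 1/p - 1/q"
  have \<alpha>: "0 < \<alpha>" using pq by (auto simp: \<alpha>_def field_simps)
  have \<alpha>1: "\<alpha> < 1"
  proof -
    have "1/p < 1" "0 < 1/q" using pq by auto
    then show ?thesis unfolding \<alpha>_def by linarith
  qed
  obtain C1 where C1: "C1 > 0" "\<And>h n x. decr h \<and> 0 \<le> n \<and> grand_part h q 0 \<le> ennreal n \<and> 0 < x \<and> x \<le> 1 \<Longrightarrow>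
    small_part h p x \<le> ennreal (C1 * n * x powr \<alpha>)"
    using small_part_le_grand[OF pq] unfolding \<alpha>_def by blast
  obtain C2 where C2: "C2 > 0" "\<And>h n x. decr h \<and> 0 \<le> n \<and> grand_part h q 0 \<le> ennreal n \<and> 0 < x \<and> x \<le> 1 \<Longrightarrow>
    lnorm h p 0 x \<le> ennreal (C2 * n * x powr \<alpha> * (1 - ln x) powr (1/q))"
    using lnorm_le_grand[OF pq] unfolding \<alpha>_def by blast
  obtain C3 where C3: "C3 > 0" "\<And>h m x. decr h \<and> 0 \<le> m \<and> small_part h p 1 \<le> ennreal m \<and> 0 < x \<and> x \<le> 1 \<Longrightarrow>
    lnorm h q x (1/2) \<le> ennreal (C3 * m * x powr (1/q - 1/p) * (1 - ln x) powr (1/p - 1))"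
    using lnorm_tail_le_small[OF pq] by blast
  \<comment> \<open>The coefficient of \<open>m\<close> will be \<open>32 + 16 * C3\<close>, that of
    \<open>t * n\<close> will be \<open>8 * C1 * c + 8 * C2 * c + 16\<close>; \<open>C\<close> is
    their sum.\<close>
  define C where "C = 48 + 8 * C1 * c + 8 * C2 * c + 16 * C3"
  have C: "0 < C" using C1 C2 C3 c by (auto simp: C_def intro!: add_pos_pos)
  show ?thesis
  proof (intro exI[of _ C] conjI allI impI C)
    fix F h k :: "real \<Rightarrow> real" and \<phi> t :: real
    assume "cut_point p q c \<phi> t \<and> decr h \<and> decr k \<and>
      (\<forall>s. 0 < s \<and> s < 1 \<longrightarrow> 0 \<le> F s \<and> F s \<le> h (s / 2) + k (s / 2))"
    then have cp: "cut_point p q c \<phi> t" and hk: "decr h" "decr k"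
      and F: "\<And>s. 0 < s \<Longrightarrow> s < 1 \<Longrightarrow> 0 \<le> F s \<and> F s \<le> h (s / 2) + k (s / 2)"
      by auto
    from cp have \<phi>: "0 < \<phi>" "\<phi> < 1" "0 < t" "t < 1"
      and H1: "\<phi> powr \<alpha> * (1 - ln \<phi>) powr (1 - \<alpha>) \<le> c * t"
      and H2: "\<And>s. \<phi> \<le> s \<Longrightarrow> s < 1 \<Longrightarrow> t \<le> s powr \<alpha> * (1 - ln s) powr (1 - \<alpha>)"
      and H3: "1 - ln t \<le> 1 - ln \<phi>"
      by (auto simp: cut_point_def \<alpha>_def)
    define L where "L = 1 - ln \<phi>"
    have L: "1 \<le> L" using \<phi> by (simp add: L_def)
    show "Kterm F p q \<phi> t \<le> ennreal C * (small_part h p 1 + ennreal t * grand_part k q 0)"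
    proof (cases "small_part h p 1 = top \<or> grand_part k q 0 = top")
      case True
      then have "ennreal C * (small_part h p 1 + ennreal t * grand_part k q 0) = top"
        using C \<phi> by (auto simp: ennreal_mult_top)
      then show ?thesis by simp
    next
      case False
      then obtain m n where m: "0 \<le> m" "small_part h p 1 = ennreal m" and n: "0 \<le> n" "grand_part k q 0 = ennreal n"
        by (metis ennreal_cases)
      have \<phi>t: "\<phi> powr \<alpha> \<le> c * t"
      proof -
        have "\<phi> powr \<alpha> * 1 \<le> \<phi> powr \<alpha> * L powr (1 - \<alpha>)"
          using L \<alpha>1 by (intro mult_left_mono ge_one_powr_ge_zero) auto
        with H1 show ?thesis by (simp add: L_def)
      qed
      have T1: "small_part F p \<phi> \<le> ennreal (8 * (m + C1 * n * (c * t)))"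
      proof -
        have "small_part F p \<phi> \<le> 8 * (small_part h p \<phi> + small_part k p \<phi>)"
          using hk pq \<phi> F by (intro small_part_add_dilation_le) auto
        also have "\<dots> \<le> 8 * (ennreal m + ennreal (C1 * n * \<phi> powr \<alpha>))"
          using small_part_mono[of \<phi> 1 h p] \<phi> m n hk by (intro mult_left_mono add_mono C1(2)) auto
        also have "\<dots> = ennreal (8 * (m + C1 * n * \<phi> powr \<alpha>))"
          using m n C1(1) by (intro numeral_mult_ennreal_add) auto
        also have "\<dots> \<le> ennreal (8 * (m + C1 * n * (c * t)))"
          using \<phi>t n C1 by (intro ennreal_leI mult_left_mono add_left_mono) auto
        finally show ?thesis .
      qed
      have T2: "ennreal ((1 - ln t) powr ((p - 1) / p)) * lnorm F p 0 \<phi> \<le> ennreal (8 * (3 * m + C2 * n * (c * t)))"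
      proof -
        have "lnorm F p 0 \<phi> \<le> 8 * (lnorm h p (0/2) (\<phi>/2) + lnorm k p (0/2) (\<phi>/2))"
          using hk pq \<phi> F by (intro lnorm_add_dilation_le) auto
        also have "\<dots> \<le> 8 * (ennreal (3 * m * (1 - ln (\<phi>/2)) powr (1/p - 1)) + ennreal (C2 * n * \<phi> powr \<alpha> * L powr (1/q)))"
        proof (intro mult_left_mono add_mono)
          \<comment> \<open>The halved endpoint lies below 1/2, within the reach of the small-norm
            estimate.\<close>
          show "lnorm h p (0/2) (\<phi>/2) \<le> ennreal (3 * m * (1 - ln (\<phi>/2)) powr (1/p - 1))"
            using lnorm_le_small[of p m h "\<phi>/2"] \<phi> m pq by simp
          have "lnorm k p (0/2) (\<phi>/2) \<le> lnorm k p 0 \<phi>"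
            using pq \<phi> by (intro lnorm_subset) auto
          also have "\<dots> \<le> ennreal (C2 * n * \<phi> powr \<alpha> * L powr (1/q))"
            unfolding L_def using hk n \<phi> by (intro C2(2)) auto
          finally show "lnorm k p (0/2) (\<phi>/2) \<le> ennreal (C2 * n * \<phi> powr \<alpha> * L powr (1/q))" .
        qed auto
        also have "\<dots> \<le> 8 * (ennreal (3 * m * L powr (1/p - 1)) + ennreal (C2 * n * \<phi> powr \<alpha> * L powr (1/q)))"
          using one_minus_ln_half[of \<phi>] ln_less_one[of \<phi>] \<phi> m pq
          by (intro mult_left_mono add_right_mono ennreal_leI powr_mono2') (auto simp: L_def)
        also have "\<dots> = ennreal (8 * (3 * m * L powr (1/p - 1) + C2 * n * \<phi> powr \<alpha> * L powr (1/q)))"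
          using m n C2(1) by (intro numeral_mult_ennreal_add) auto
        finally have "ennreal ((1 - ln t) powr ((p - 1) / p)) * lnorm F p 0 \<phi>
            \<le> ennreal (L powr ((p - 1) / p)) * ennreal (8 * (3 * m * L powr (1/p - 1) + C2 * n * \<phi> powr \<alpha> * L powr (1/q)))"
          using H3 \<phi> pq ln_less_one[of t] by (intro mult_mono ennreal_leI powr_mono2) (auto simp: L_def)
        also have "\<dots> = ennreal (L powr ((p - 1) / p) * (8 * (3 * m * L powr (1/p - 1) + C2 * n * \<phi> powr \<alpha> * L powr (1/q))))"
          using m n C2 by (subst ennreal_mult[symmetric]) auto
        also have "L powr ((p - 1) / p) * (8 * (3 * m * L powr (1/p - 1) + C2 * n * \<phi> powr \<alpha> * L powr (1/q)))
            = 8 * (3 * m * (L powr ((p - 1) / p) * L powr (1/p - 1)) + C2 * n * (\<phi> powr \<alpha> * (L powr ((p - 1) / p) * L powr (1/q))))"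
          by (simp add: algebra_simps)
        also have "L powr ((p - 1) / p) * L powr (1/p - 1) = 1"
          using L pq by (simp add: powr_add[symmetric] diff_divide_distrib)
        \<comment> \<open>Here the exponents meet: together with \<open>\<phi> powr \<alpha>\<close>
          this is the quantity that \<open>H1\<close> bounds by \<open>c * t\<close>.\<close>
        also have "L powr ((p - 1) / p) * L powr (1/q) = L powr (1 - \<alpha>)"
          using L pq by (simp add: powr_add[symmetric] \<alpha>_def diff_divide_distrib algebra_simps)
        also have "ennreal (8 * (3 * m * 1 + C2 * n * (\<phi> powr \<alpha> * L powr (1 - \<alpha>)))) \<le> ennreal (8 * (3 * m * 1 + C2 * n * (c * t)))"
          using H1 n C2 by (intro ennreal_leI mult_left_mono add_left_mono) (auto simp: L_def)
        finally show ?thesis by simp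
      qed
      have T3: "ennreal t * grand_part F q \<phi> \<le> ennreal (8 * (2 * C3 * m + 2 * t * n))"
      proof -
        have "ennreal t * (ennreal ((1 - ln s) powr (-1/q)) * lnorm F q s 1) \<le> ennreal (8 * (2 * C3 * m + 2 * t * n))"
          if s: "\<phi> < s" "s < 1" for s
        proof -
          define l where "l = 1 - ln s"
          define l' where "l' = 1 - ln (s/2)"
          have s0: "0 < s" using s \<phi> by simp
          have l: "1 \<le> l" "l \<le> l'" "l' \<le> 2 * l"
            using one_minus_ln_half[of s] s s0 by (auto simp: l_def l'_def)
          have k1: "ennreal (l powr (-1/q)) * lnorm k q (s/2) (1/2) \<le> ennreal (2 * n)"
          proof -
            \<comment> \<open>Halving the argument at most doubles \<open>1 - ln s\<close>, so the
              weight at \<open>s\<close> may be replaced by the one at \<open>s / 2\<close>, where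
              the supremum for \<open>k\<close> is tested.\<close>
            have "l powr (-1/q) \<le> 2 * l' powr (-1/q)"
            proof -
              have "l' powr (1/q) \<le> (2 * l) powr (1/q)"
                using l pq by (intro powr_mono2) auto
              also have "\<dots> = 2 powr (1/q) * l powr (1/q)" using l by (subst powr_mult) auto
              also have "\<dots> \<le> 2 powr 1 * l powr (1/q)"
                using pq by (intro mult_right_mono powr_mono) auto
              finally have "l' powr (1/q) \<le> 2 * l powr (1/q)" by simp
              then show ?thesis using l by (simp add: powr_minus_divide field_simps)
            qed
            then have "ennreal (l powr (-1/q)) * lnorm k q (s/2) (1/2) \<le> ennreal (2 * l' powr (-1/q)) * lnorm k q (s/2) 1"
              using pq by (intro mult_mono ennreal_leI lnorm_subset) auto
            also have "\<dots> = 2 * (ennreal (l' powr (-1/q)) * lnorm k q (s/2) 1)"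
              by (simp add: ennreal_mult mult.assoc)
            also have "\<dots> \<le> 2 * grand_part k q 0"
              unfolding grand_part_def l'_def using s s0 by (intro mult_left_mono SUP_upper) auto
            finally show ?thesis using n by (simp add: ennreal_mult)
          qed
          have h1: "ennreal t * (ennreal (l powr (-1/q)) * lnorm h q (s/2) (1/2)) \<le> ennreal (2 * C3 * m)"
          proof -
            have "lnorm h q (s/2) (1/2) \<le> ennreal (C3 * m * (s/2) powr (1/q - 1/p) * l' powr (1/p - 1))"
              unfolding l'_def using hk m s s0 by (intro C3(2)) auto
            also have "\<dots> \<le> ennreal (C3 * m * (2 * s powr (- \<alpha>)) * l powr (1/p - 1))"
            proof (intro ennreal_leI mult_mono mult_left_mono)
              have "(s/2) powr (1/q - 1/p) = 2 powr \<alpha> * s powr (- \<alpha>)"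
                using s0 by (simp add: powr_divide \<alpha>_def powr_diff)
              also have "\<dots> \<le> 2 powr 1 * s powr (- \<alpha>)"
                using \<alpha>1 by (intro mult_right_mono powr_mono) auto
              finally show "(s/2) powr (1/q - 1/p) \<le> 2 * s powr (- \<alpha>)" by simp
              show "l' powr (1/p - 1) \<le> l powr (1/p - 1)"
                using l pq by (intro powr_mono2') auto
            qed (use C3 m in auto)
            finally have "ennreal t * (ennreal (l powr (-1/q)) * lnorm h q (s/2) (1/2))
                \<le> ennreal t * (ennreal (l powr (-1/q)) * ennreal (C3 * m * (2 * s powr (- \<alpha>)) * l powr (1/p - 1)))"
              by (intro mult_left_mono) auto
            also have "\<dots> = ennreal (t * (l powr (-1/q) * (C3 * m * (2 * s powr (- \<alpha>)) * l powr (1/p - 1))))"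
              using \<phi> C3 m by (simp add: ennreal_mult[symmetric])
            also have "t * (l powr (-1/q) * (C3 * m * (2 * s powr (- \<alpha>)) * l powr (1/p - 1)))
                = 2 * C3 * m * (t * (s powr (- \<alpha>) * (l powr (-1/q) * l powr (1/p - 1))))"
              by (simp add: mult_ac)
            also have "l powr (-1/q) * l powr (1/p - 1) = l powr (- (1 - \<alpha>))"
              using l by (simp add: powr_add[symmetric] \<alpha>_def algebra_simps)
            \<comment> \<open>The lower bound for
              \<open>x powr \<alpha> * (1 - ln x) powr (1 - \<alpha>)\<close> is needed at
              \<open>s\<close> itself, not only at \<phi>.\<close>
            also have "ennreal (2 * C3 * m * (t * (s powr (- \<alpha>) * l powr (- (1 - \<alpha>))))) \<le> ennreal (2 * C3 * m * 1)"
            proof (intro ennreal_leI mult_left_mono)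
              have "t * (s powr (- \<alpha>) * l powr (- (1 - \<alpha>)))
                  \<le> (s powr \<alpha> * l powr (1 - \<alpha>)) * (s powr (- \<alpha>) * l powr (- (1 - \<alpha>)))"
                using H2[of s] s by (intro mult_right_mono) (auto simp: l_def)
              also have "\<dots> = (s powr \<alpha> * s powr (- \<alpha>)) * (l powr (1 - \<alpha>) * l powr (- (1 - \<alpha>)))"
                by (simp only: mult_ac)
              also have "\<dots> = 1"
                using s0 l by (simp only: powr_add[symmetric]) simp
              finally show "t * (s powr (- \<alpha>) * l powr (- (1 - \<alpha>))) \<le> 1" .
            qed (use C3 m in auto)
            finally show ?thesis by simp
          qed
          have "lnorm F q s 1 \<le> 8 * (lnorm h q (s/2) (1/2) + lnorm k q (s/2) (1/2))"
            using hk pq s0 F by (intro lnorm_add_dilation_le) auto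
          then have "ennreal t * (ennreal (l powr (-1/q)) * lnorm F q s 1)
              \<le> ennreal t * (ennreal (l powr (-1/q)) * (8 * (lnorm h q (s/2) (1/2) + lnorm k q (s/2) (1/2))))"
            by (intro mult_left_mono) auto
          also have "\<dots> = 8 * (ennreal t * (ennreal (l powr (-1/q)) * lnorm h q (s/2) (1/2))
              + ennreal t * (ennreal (l powr (-1/q)) * lnorm k q (s/2) (1/2)))"
            by (simp add: distrib_left mult_ac)
          also have "\<dots> \<le> 8 * (ennreal (2 * C3 * m) + ennreal t * ennreal (2 * n))"
            using h1 k1 by (intro mult_left_mono add_mono) auto
          also have "\<dots> = ennreal (8 * (2 * C3 * m + 2 * t * n))"
          proof -
            have "ennreal t * ennreal (2 * n) = ennreal (2 * t * n)"
              using n \<phi> by (subst ennreal_mult[symmetric]) (auto simp: mult_ac)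
            moreover have "8 * (ennreal (2 * C3 * m) + ennreal (2 * t * n)) = ennreal (8 * (2 * C3 * m + 2 * t * n))"
              using n \<phi> m C3(1) by (intro numeral_mult_ennreal_add) auto
            ultimately show ?thesis by simp
          qed
          finally show ?thesis by (simp add: l_def)
        qed
        then show ?thesis
          unfolding grand_part_def SUP_mult_left_ennreal by (intro SUP_least) auto
      qed
      have "Kterm F p q \<phi> t \<le> ennreal (8 * (m + C1 * n * (c * t))) + ennreal (8 * (3 * m + C2 * n * (c * t)))
          + ennreal (8 * (2 * C3 * m + 2 * t * n))"
        unfolding Kterm_def by (intro add_mono T1 T2 T3)
      also have "\<dots> = ennreal (8 * (m + C1 * n * (c * t)) + 8 * (3 * m + C2 * n * (c * t)) + 8 * (2 * C3 * m + 2 * t * n))"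
        using m n C1 C2 C3 c \<phi> by (subst ennreal_plus[symmetric], simp, simp)+ simp
      also have "\<dots> \<le> ennreal (C * (m + t * n))"
      proof (intro ennreal_leI)
        have "0 \<le> C1 * c * m" "0 \<le> C2 * c * m" "0 \<le> C3 * (t * n)" "0 \<le> t * n"
          using m n C1 C2 C3 c \<phi> by auto
        then show "8 * (m + C1 * n * (c * t)) + 8 * (3 * m + C2 * n * (c * t)) + 8 * (2 * C3 * m + 2 * t * n) \<le> C * (m + t * n)"
          using m by (simp add: C_def algebra_simps)
      qed
      also have "\<dots> = ennreal C * (small_part h p 1 + ennreal t * grand_part k q 0)"
        using m n C \<phi> by (simp add: ennreal_mult)
      finally show ?thesis .
    qed
  qed
qed

text \<open>Cutting at height \<open>F \<phi>\<close> creates two extra contributions, both absorbed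
  by the middle term. Beyond \<phi> the integral of \<open>h\<close> is at most \<open>E\<close>,
  and the weight there has mass at most \<open>L powr \<gamma> / \<gamma>\<close>. Below \<phi> the
  function \<open>k\<close> is at most \<open>F \<phi>\<close>, and \<open>t\<close> times the
  resulting grand norm is at most a multiple of
  \<open>L powr \<gamma> * F \<phi> * \<phi> powr (1/p)\<close>, hence of
  \<open>L powr \<gamma> * E\<close>.\<close>

lemma Kterm_upper:
  assumes pq: "1 < p" "p < q" and c: "1 \<le> c"
  shows "\<exists>C>0. \<forall>F h k \<phi> t. cut_point p q c \<phi> t \<and> decr F \<and> decr h \<and> decr k \<and>
      (\<forall>s. 0 < s \<and> s < 1 \<longrightarrow> h s \<le> F s \<and> k s \<le> F s \<and> k s \<le> F \<phi>) \<and>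
      (\<forall>s. \<phi> \<le> s \<and> s < 1 \<longrightarrow> h s = 0) \<longrightarrow>
    small_part h p 1 + ennreal t * grand_part k q 0 \<le> ennreal C * Kterm F p q \<phi> t"
proof -
  define \<alpha> where "\<alpha> = 1/p - 1/q"
  define \<gamma> where "\<gamma> = 1 - 1/p"
  have \<gamma>: "0 < \<gamma>" "\<gamma> < 1" "(p - 1) / p = \<gamma>" using pq by (auto simp: \<gamma>_def diff_divide_distrib)
  define C where "C = 2 + (1 / \<gamma> + 4) * c"
  have C: "0 < C" using c \<gamma>(1) by (auto simp: C_def intro!: add_pos_pos mult_pos_pos)
  show ?thesis
  proof (intro exI[of _ C] conjI allI impI C)
    fix F h k :: "real \<Rightarrow> real" and \<phi> t :: real
    assume "cut_point p q c \<phi> t \<and> decr F \<and> decr h \<and> decr k \<and>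
      (\<forall>s. 0 < s \<and> s < 1 \<longrightarrow> h s \<le> F s \<and> k s \<le> F s \<and> k s \<le> F \<phi>) \<and>
      (\<forall>s. \<phi> \<le> s \<and> s < 1 \<longrightarrow> h s = 0)"
    then have cp: "cut_point p q c \<phi> t" and d: "decr F" "decr h" "decr k"
      and le: "\<And>s. 0 < s \<Longrightarrow> s < 1 \<Longrightarrow> h s \<le> F s" "\<And>s. 0 < s \<Longrightarrow> s < 1 \<Longrightarrow> k s \<le> F s"
        "\<And>s. 0 < s \<Longrightarrow> s < 1 \<Longrightarrow> k s \<le> F \<phi>"
      and h0: "\<And>s. \<phi> \<le> s \<Longrightarrow> s < 1 \<Longrightarrow> h s = 0"
      by auto
    from cp have \<phi>: "0 < \<phi>" "\<phi> < 1" "0 < t" "t < 1"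
      and H2: "t \<le> \<phi> powr \<alpha> * (1 - ln \<phi>) powr (1 - \<alpha>)"
      and H4: "1 - ln \<phi> \<le> c * (1 - ln t)"
      by (auto simp: cut_point_def \<alpha>_def)
    define L where "L = 1 - ln \<phi>"
    have L: "1 \<le> L" using \<phi> by (simp add: L_def)
    define E where "E = lnorm F p 0 \<phi>"
    define T where "T = ennreal ((1 - ln t) powr ((p - 1) / p)) * E"
    define S where "S = grand_part F q \<phi>"
    \<comment> \<open>Passing from the logarithm of \<phi> to that of \<open>t\<close> costs
      \<open>c powr \<gamma>\<close>, at most \<open>c\<close>; both extra contributions go through
      this.\<close>
    have LT: "ennreal (L powr \<gamma>) * E \<le> ennreal c * T"
    proof -
      have lt: "0 \<le> 1 - ln t" using ln_less_one[of t] \<phi> by simp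
      have "L powr \<gamma> \<le> (c * (1 - ln t)) powr \<gamma>"
        using H4 L \<gamma> by (intro powr_mono2) (auto simp: L_def)
      also have "\<dots> = c powr \<gamma> * (1 - ln t) powr \<gamma>"
        using c lt by (simp add: powr_mult)
      also have "\<dots> \<le> c powr 1 * (1 - ln t) powr \<gamma>"
        using c \<gamma> by (intro mult_right_mono powr_mono) auto
      finally have "L powr \<gamma> \<le> c * (1 - ln t) powr \<gamma>" using c by simp
      then have "ennreal (L powr \<gamma>) * E \<le> ennreal (c * (1 - ln t) powr \<gamma>) * E"
        by (intro mult_right_mono ennreal_leI) auto
      then show ?thesis using c by (simp add: T_def \<gamma>(3) ennreal_mult mult.assoc)
    qed
    have "small_part h p 1 \<le> small_part F p \<phi> + ennreal (1 / \<gamma>) * (ennreal c * T)"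
    proof -
      let ?w = "\<lambda>s. (1 - ln s) powr (-1/p) / s"
      have [measurable]: "(\<lambda>s. indicator {0<..<\<phi>} s * ennreal (?w s) * lnorm F p 0 s) \<in> borel_measurable borel"
        using borel_measurable_small_integrand[of p] pq by simp
      have hF: "lnorm h p 0 s \<le> lnorm F p 0 s" if "s < 1" for s
        using that pq le decr_nonneg[OF d(2)] by (intro lnorm_mono) auto
      have hE: "lnorm h p 0 s \<le> E" if "s < 1" for s
      proof -
        have "powint h p 0 s \<le> powint F p 0 \<phi>"
          unfolding powint_def
        proof (intro nn_integral_mono)
          fix u
          show "indicator {0<..<s} u * ennreal (h u powr p) \<le> indicator {0<..<\<phi>} u * ennreal (F u powr p)"
            using that h0[of u] le(1)[of u] decr_nonneg[OF d(2), of u] pq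
            by (cases "u < \<phi>") (auto simp: indicator_def intro!: ennreal_leI powr_mono2)
        qed
        then show ?thesis
          unfolding E_def lnorm_def using pq by (intro ennpow_mono) auto
      qed
      have "small_part h p 1 \<le> (\<integral>\<^sup>+s. indicator {0<..<\<phi>} s * ennreal (?w s) * lnorm F p 0 s
          + indicator {\<phi><..<1} s * ennreal (?w s) * E \<partial>lborel)"
        unfolding small_part_def
      proof (intro nn_integral_mono_AE)
        show "AE s in lborel. indicator {0<..<1} s * ennreal (?w s) * lnorm h p 0 s
          \<le> indicator {0<..<\<phi>} s * ennreal (?w s) * lnorm F p 0 s + indicator {\<phi><..<1} s * ennreal (?w s) * E"
          using AE_lborel_singleton[of \<phi>]
        proof eventually_elim
          case (elim s)
          then show ?case
            using hF[of s] hE[of s] by (auto simp: indicator_def intro!: mult_left_mono)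
        qed
      qed
      also have "\<dots> = small_part F p \<phi> + (\<integral>\<^sup>+s. indicator {\<phi><..<1} s * ennreal (?w s) * E \<partial>lborel)"
        unfolding small_part_def by (intro nn_integral_add) measurable
      also have "(\<integral>\<^sup>+s. indicator {\<phi><..<1} s * ennreal (?w s) * E \<partial>lborel)
          = (\<integral>\<^sup>+s. indicator {\<phi><..<1} s * ennreal (?w s) \<partial>lborel) * E"
        by (intro nn_integral_multc) measurable
      also have "\<dots> \<le> ennreal (L powr \<gamma> / \<gamma>) * E"
        using nn_integral_log_weight[of \<phi> "1/p"] \<phi> pq
        by (intro mult_right_mono) (auto simp: L_def \<gamma>_def)
      also have "\<dots> = ennreal (1 / \<gamma>) * (ennreal (L powr \<gamma>) * E)"
        using \<gamma> by (simp add: mult.assoc[symmetric] ennreal_mult[symmetric])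
      also have "\<dots> \<le> ennreal (1 / \<gamma>) * (ennreal c * T)"
        by (intro mult_left_mono LT) simp
      finally show ?thesis by (simp add: add_left_mono)
    qed
    moreover have "ennreal t * grand_part k q 0 \<le> 2 * (ennreal t * S) + 4 * (ennreal c * T)"
    proof -
      define l where "l = F \<phi>"
      have l: "0 \<le> l" using d \<phi> decr_nonneg by (auto simp: l_def)
      \<comment> \<open>The supremum defining \<open>S\<close> excludes \<open>\<phi>\<close> itself, so the integral is split slightly to its right.\<close>
      define s' where "s' = (if 2 * \<phi> < 1 then 2 * \<phi> else (1 + \<phi>) / 2)"
      have s': "\<phi> < s'" "s' < 1" "s' \<le> 2 * \<phi>" using \<phi> by (auto simp: s'_def)
      have key: "ennreal ((1 - ln s) powr (-1/q)) * lnorm k q s 1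
          \<le> 2 * S + ennreal (4 * (l * \<phi> powr (1/q) * L powr (-1/q)))" if s: "0 < s" "s < 1" for s
      proof (cases "\<phi> < s")
        case True
        have "lnorm k q s 1 \<le> lnorm F q s 1"
          using s pq le decr_nonneg[OF d(3)] by (intro lnorm_mono) auto
        then have "ennreal ((1 - ln s) powr (-1/q)) * lnorm k q s 1 \<le> ennreal ((1 - ln s) powr (-1/q)) * lnorm F q s 1"
          by (intro mult_left_mono) auto
        also have "\<dots> \<le> S"
          unfolding S_def grand_part_def using True s by (intro SUP_upper) auto
        also have "S \<le> 2 * S + ennreal (4 * (l * \<phi> powr (1/q) * L powr (-1/q)))"
          by (simp add: mult_2 add.assoc)
        finally show ?thesis .
      next
        case False
        have kl: "powint k q s s' \<le> ennreal (l powr q * (2 * \<phi>))"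
        proof -
          have "powint k q s s' \<le> ennreal (l powr q * (s' - s))"
            using s s' le decr_nonneg[OF d(3)] pq False by (intro powint_le_const) (auto simp: l_def)
          also have "\<dots> \<le> ennreal (l powr q * (2 * \<phi>))"
            using s s' by (intro ennreal_leI mult_left_mono) auto
          finally show ?thesis .
        qed
        have "powint k q s 1 \<le> powint k q s s' + powint k q s' 1"
          using d s s' False by (intro powint_split) auto
        also have "\<dots> \<le> ennreal (l powr q * (2 * \<phi>)) + powint F q s' 1"
          using kl s s' \<phi> le decr_nonneg[OF d(3)] pq by (intro add_mono powint_mono) auto
        finally have "lnorm k q s 1 \<le> ennpow (ennreal (l powr q * (2 * \<phi>)) + powint F q s' 1) (1/q)"
          unfolding lnorm_def using pq by (intro ennpow_mono) auto
        also have "\<dots> \<le> ennreal (2 powr (1/q)) * (ennpow (ennreal (l powr q * (2 * \<phi>))) (1/q) + lnorm F q s' 1)"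
          unfolding lnorm_def using pq by (intro ennpow_add_le) auto
        also have "\<dots> \<le> ennreal 2 * (ennreal (2 * (l * \<phi> powr (1/q))) + lnorm F q s' 1)"
        proof -
          have two: "2 powr (1/q) \<le> (2::real)"
            using powr_mono[of "1/q" 1 "2::real"] pq by simp
          have "(l powr q * (2 * \<phi>)) powr (1/q) = 2 powr (1/q) * (l * \<phi> powr (1/q))"
            using l \<phi> pq by (simp add: powr_mult powr_powr)
          also have "\<dots> \<le> 2 * (l * \<phi> powr (1/q))"
            using two l by (intro mult_right_mono) auto
          finally show ?thesis
            using two l \<phi> by (intro mult_mono add_mono ennreal_leI) (auto intro!: ennreal_leI)
        qed
        \<comment> \<open>The weight increases with its argument, so for
          \<open>s \<le> \<phi>\<close> it is at most its value at \<phi>, and later that one at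
          most the value at \<open>s'\<close>, where the supremum \<open>S\<close> is
          available.\<close>
        finally have "ennreal ((1 - ln s) powr (-1/q)) * lnorm k q s 1
            \<le> ennreal (L powr (-1/q)) * (2 * (ennreal (2 * (l * \<phi> powr (1/q))) + lnorm F q s' 1))"
          using s pq False L \<phi> ln_less_one[of \<phi>] by (intro mult_mono ennreal_leI powr_mono2') (auto simp: L_def)
        also have "\<dots> = 2 * (ennreal (L powr (-1/q)) * lnorm F q s' 1) + 2 * (ennreal (L powr (-1/q)) * ennreal (2 * (l * \<phi> powr (1/q))))"
          by (simp add: distrib_left mult_ac add.commute)
        also have "2 * (ennreal (L powr (-1/q)) * ennreal (2 * (l * \<phi> powr (1/q)))) = ennreal (4 * (l * \<phi> powr (1/q) * L powr (-1/q)))"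
        proof -
          have "ennreal (L powr (-1/q)) * ennreal (2 * (l * \<phi> powr (1/q))) = ennreal (L powr (-1/q) * (2 * (l * \<phi> powr (1/q))))"
            using l by (intro ennreal_mult[symmetric]) auto
          moreover have "2 * ennreal (L powr (-1/q) * (2 * (l * \<phi> powr (1/q)))) = ennreal (2 * (L powr (-1/q) * (2 * (l * \<phi> powr (1/q)))))"
            using l by (subst ennreal_mult) auto
          ultimately show ?thesis by (simp add: mult_ac)
        qed
        also have "ennreal (L powr (-1/q)) * lnorm F q s' 1 \<le> ennreal ((1 - ln s') powr (-1/q)) * lnorm F q s' 1"
          using s' \<phi> pq ln_less_one[of s'] by (intro mult_right_mono ennreal_leI powr_mono2') (auto simp: L_def)
        also have "\<dots> \<le> S"
          unfolding S_def grand_part_def using s' by (intro SUP_upper) auto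
        finally show ?thesis by (simp add: add_mono mult_left_mono)
      qed
      have "grand_part k q 0 \<le> 2 * S + ennreal (4 * (l * \<phi> powr (1/q) * L powr (-1/q)))"
        unfolding grand_part_def by (intro SUP_least key) auto
      then have "ennreal t * grand_part k q 0 \<le> ennreal t * (2 * S + ennreal (4 * (l * \<phi> powr (1/q) * L powr (-1/q))))"
        by (intro mult_left_mono) auto
      also have "\<dots> = 2 * (ennreal t * S) + ennreal t * ennreal (4 * (l * \<phi> powr (1/q) * L powr (-1/q)))"
        by (simp add: distrib_left mult_ac)
      also have "ennreal t * ennreal (4 * (l * \<phi> powr (1/q) * L powr (-1/q)))
          = ennreal (t * (4 * (l * \<phi> powr (1/q) * L powr (-1/q))))"
        using \<phi> l by (intro ennreal_mult[symmetric]) auto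
      also have "\<dots> \<le> ennreal (4 * (L powr \<gamma> * (l * \<phi> powr (1/p))))"
      proof (intro ennreal_leI)
        \<comment> \<open>Replacing \<open>t\<close> by its upper bound at \<phi> raises the power
          of \<phi> from 1/q to 1/p and that of \<open>L\<close> from -1/q to \<gamma>, exactly what
          the middle term carries.\<close>
        have "t * (4 * (l * \<phi> powr (1/q) * L powr (-1/q)))
            \<le> (\<phi> powr \<alpha> * L powr (1 - \<alpha>)) * (4 * (l * \<phi> powr (1/q) * L powr (-1/q)))"
          using H2 l by (intro mult_right_mono) (auto simp: L_def)
        also have "\<dots> = 4 * ((L powr (1 - \<alpha>) * L powr (-1/q)) * (l * (\<phi> powr \<alpha> * \<phi> powr (1/q))))"
          by (simp only: mult_ac)
        also have "\<phi> powr \<alpha> * \<phi> powr (1/q) = \<phi> powr (1/p)"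
          by (simp add: powr_add[symmetric] \<alpha>_def)
        also have "L powr (1 - \<alpha>) * L powr (-1/q) = L powr \<gamma>"
          by (simp add: powr_add[symmetric] \<alpha>_def \<gamma>_def algebra_simps)
        finally show "t * (4 * (l * \<phi> powr (1/q) * L powr (-1/q))) \<le> 4 * (L powr \<gamma> * (l * \<phi> powr (1/p)))" .
      qed
      also have "\<dots> = 4 * (ennreal (L powr \<gamma>) * ennreal (l * \<phi> powr (1/p)))"
        using l by (simp add: ennreal_mult)
      also have "\<dots> \<le> 4 * (ennreal (L powr \<gamma>) * E)"
      proof (intro mult_left_mono)
        have "ennreal (l * (\<phi> - 0) powr (1/p)) \<le> E"
          unfolding E_def using l pq \<phi> decr_antimono[OF d(1)]
          by (intro const_le_lnorm) (auto simp: l_def)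
        then show "ennreal (l * \<phi> powr (1/p)) \<le> E" by simp
      qed auto
      also have "\<dots> \<le> 4 * (ennreal c * T)"
        by (intro mult_left_mono LT) auto
      finally show ?thesis by (simp add: add_left_mono)
    qed
    ultimately have "small_part h p 1 + ennreal t * grand_part k q 0
        \<le> (small_part F p \<phi> + ennreal (1 / \<gamma>) * (ennreal c * T)) + (2 * (ennreal t * S) + 4 * (ennreal c * T))"
      by (rule add_mono)
    also have "\<dots> = small_part F p \<phi> + ennreal ((1 / \<gamma> + 4) * c) * T + 2 * (ennreal t * S)"
    proof -
      have "ennreal ((1 / \<gamma> + 4) * c) = (ennreal (1 / \<gamma>) + 4) * ennreal c"
        using \<gamma> c by (subst ennreal_mult) auto
      then show ?thesis by (simp only: distrib_right mult.assoc add_ac)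
    qed
    also have "\<dots> \<le> ennreal C * small_part F p \<phi> + ennreal C * T + ennreal C * (ennreal t * S)"
    proof (intro add_mono)
      have C2: "2 \<le> C" "(1 / \<gamma> + 4) * c \<le> C" using \<gamma> c by (auto simp: C_def)
      have "1 * small_part F p \<phi> \<le> ennreal C * small_part F p \<phi>"
        using C2 by (intro mult_right_mono) auto
      then show "small_part F p \<phi> \<le> ennreal C * small_part F p \<phi>" by simp
      show "ennreal ((1 / \<gamma> + 4) * c) * T \<le> ennreal C * T"
        using C2 by (intro mult_right_mono ennreal_leI) auto
      have "(2::ennreal) \<le> ennreal C" using ennreal_leI[OF C2(1)] by simp
      then show "2 * (ennreal t * S) \<le> ennreal C * (ennreal t * S)"
        by (intro mult_right_mono) auto
    qed
    also have "\<dots> = ennreal C * Kterm F p q \<phi> t"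
      by (simp add: Kterm_def T_def E_def S_def distrib_left)
    finally show "small_part h p 1 + ennreal t * grand_part k q 0 \<le> ennreal C * Kterm F p q \<phi> t" .
  qed
qed

section \<open>Construction of the function \<phi>\<close>

text \<open>The derivative \<open>a - (1 - a) * a / (1 + a * u)\<close> lies between
  \<open>a\<^sup>2\<close> and \<open>a\<close>; the proof gets the same bounds on increments from
  \<open>ln y \<le> y - 1\<close> and the monotonicity of the logarithm. This \<open>g\<close> is
  the function to be inverted, in the coordinates \<open>u = - ln x\<close> and
  \<open>- ln t\<close>.\<close>

lemma log_perturbation_diff:
  fixes a u v :: real
  assumes "0 < a" "a < 1" "0 \<le> u" "u \<le> v"
  defines "g \<equiv> \<lambda>u. a * u - (1 - a) * ln (1 + a * u)"
  shows "a\<^sup>2 * (v - u) \<le> g v - g u" "g v - g u \<le> a * (v - u)"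
proof -
  have au: "0 \<le> a * u" "a * u \<le> a * v" using assms by (auto intro: mult_left_mono)
  have "ln (1 + a * v) - ln (1 + a * u) = ln ((1 + a * v) / (1 + a * u))"
    using au by (subst ln_div) auto
  also have "\<dots> \<le> (1 + a * v) / (1 + a * u) - 1"
    using au by (intro ln_le_minus_one divide_pos_pos) auto
  also have "\<dots> = (a * v - a * u) / (1 + a * u)"
    using au by (simp add: field_simps)
  also have "\<dots> \<le> (a * v - a * u) / 1"
    using au by (intro divide_left_mono) auto
  finally have "(1 - a) * (ln (1 + a * v) - ln (1 + a * u)) \<le> (1 - a) * (a * (v - u))"
    using assms by (intro mult_left_mono) (auto simp: algebra_simps)
  then show "a\<^sup>2 * (v - u) \<le> g v - g u"
    by (simp add: g_def algebra_simps power2_eq_square)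
  have "ln (1 + a * u) \<le> ln (1 + a * v)" using au by simp
  then have "0 \<le> (1 - a) * (ln (1 + a * v) - ln (1 + a * u))"
    using assms by (intro mult_nonneg_nonneg) auto
  then show "g v - g u \<le> a * (v - u)"
    by (simp add: g_def algebra_simps)
qed

text \<open>In logarithmic coordinates \<psi> becomes \<open>g\<close>, which is strictly increasing
  with slopes in \<open>[a\<^sup>2, a]\<close>; hence \<psi> is a bijection and the logarithms of
  \<open>t\<close> and \<open>\<phi> t\<close> are comparable. The plain logarithm returns through
  \<open>a * (1 - ln x) \<le> 1 - a * ln x \<le> 1 - ln x\<close>.\<close>

lemma ex_cut_point:
  assumes pq: "1 < p" "p < q"
  shows "\<exists>\<phi> c. bij_betw \<phi> {0..1} {0..1::real} \<and> (\<forall>t\<in>{0<..<1}. cut_point p q c (\<phi> t) t)"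
proof -
  define a where "a = 1/p - 1/q"
  have a: "0 < a" using pq by (simp add: a_def field_simps)
  have a1: "a < 1"
  proof -
    have "1/p < 1" "0 < 1/q" using pq by auto
    then show ?thesis unfolding a_def by linarith
  qed
  define g where "g = (\<lambda>u::real. a * u - (1 - a) * ln (1 + a * u))"
  have g0: "g 0 = 0" by (simp add: g_def)
  have g: "a\<^sup>2 * (v - u) \<le> g v - g u" "g v - g u \<le> a * (v - u)" if "0 \<le> u" "u \<le> v" for u v
    using log_perturbation_diff[OF a a1 that] by (simp_all add: g_def)
  have g_less: "g u < g v" if "0 \<le> u" "u < v" for u v
  proof -
    have "0 < a\<^sup>2 * (v - u)" using a that by simp
    then show ?thesis using g(1)[of u v] that by linarith
  qed
  \<comment> \<open>With the factor \<open>a\<close> in front of the logarithm the function is monotone on all of \<open>[0, 1]\<close>.\<close>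
  define \<psi> where "\<psi> = (\<lambda>x::real. x powr a * (1 - a * ln x) powr (1 - a))"
  have \<psi>0: "\<psi> 0 = 0" by (simp add: \<psi>_def)
  have \<psi>: "\<psi> x = exp (- g (- ln x))" if "0 < x" "x \<le> 1" for x
  proof -
    have "a * ln x \<le> 0" using that a by (intro mult_nonneg_nonpos) auto
    then have "0 < 1 - a * ln x" by linarith
    then show ?thesis
      using that by (simp add: \<psi>_def g_def powr_def exp_add[symmetric] algebra_simps)
  qed
  have \<psi>_less: "\<psi> x < \<psi> y" if "0 \<le> x" "x < y" "y \<le> 1" for x y
  proof (cases "x = 0")
    case True
    then show ?thesis using that \<psi>[of y] by (simp add: \<psi>0)
  next
    case False
    then show ?thesis using that g_less[of "- ln y" "- ln x"] by (simp add: \<psi>)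
  qed
  have \<psi>1: "\<psi> 1 = 1" by (simp add: \<psi>_def)
  have \<psi>_bij: "bij_betw \<psi> {0..1} {0..1}"
    unfolding bij_betw_def
  proof
    show "inj_on \<psi> {0..1}"
      by (intro linorder_inj_onI) (use \<psi>_less in force)+
    show "\<psi> ` {0..1} = {0..1}"
    proof (intro equalityI subsetI)
      fix y assume "y \<in> \<psi> ` {0..1}"
      then obtain x where x: "0 \<le> x" "x \<le> 1" "y = \<psi> x" by auto
      have "\<psi> 0 \<le> \<psi> x" using \<psi>_less[of 0 x] x by (cases "x = 0") auto
      moreover have "\<psi> x \<le> \<psi> 1" using \<psi>_less[of x 1] x by (cases "x = 1") auto
      ultimately show "y \<in> {0..1}" using x by (simp add: \<psi>0 \<psi>1)
    next
      fix y :: real assume y: "y \<in> {0..1}"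
      show "y \<in> \<psi> ` {0..1}"
      proof (cases "y = 0")
        case True
        then show ?thesis using \<psi>0 by (intro image_eqI[of _ _ 0]) auto
      next
        case False
        define z where "z = - ln y"
        have z: "0 \<le> z" using y False by (simp add: z_def)
        have "1 + a * u \<noteq> 0" if "0 \<le> u" for u
          using mult_nonneg_nonneg[of a u] a that by linarith
        then have "continuous_on {0..z / a\<^sup>2} g"
          unfolding g_def by (intro continuous_intros) auto
        \<comment> \<open>The slope of \<open>g\<close> is at least \<open>a\<^sup>2\<close>, so
          \<open>z / a\<^sup>2\<close> is far enough to the right for the intermediate value
          theorem.\<close>
        moreover have "z \<le> g (z / a\<^sup>2)"
          using g(1)[of 0 "z / a\<^sup>2"] z a by (simp add: g0)
        ultimately have "\<exists>u\<ge>0. u \<le> z / a\<^sup>2 \<and> g u = z"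
          using z a by (intro IVT') (auto simp: g0)
        then obtain u where u: "0 \<le> u" "g u = z" by blast
        have "\<psi> (exp (- u)) = y"
          using u y False by (simp add: \<psi> z_def)
        then show ?thesis using u by (intro image_eqI[of _ _ "exp (- u)"]) auto
      qed
    qed
  qed
  define \<phi> where "\<phi> = the_inv_into {0..1} \<psi>"
  \<comment> \<open>Comparing \<psi> with its undamped form costs only \<open>1 / a\<close>; the
    square comes from \<open>a\<^sup>2 * M \<le> g M\<close>, which bounds the logarithm of
    \<open>\<phi> t\<close> by that of \<open>t\<close>.\<close>
  define c where "c = 1 / a\<^sup>2"
  have ca: "1 / a \<le> c" "1 \<le> c" "1 \<le> 1 / a"
    using a a1 power_le_one[of a 2] by (auto simp: c_def field_simps power2_eq_square)
  have bij: "bij_betw \<phi> {0..1} {0..1}"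
    unfolding \<phi>_def using \<psi>_bij by (rule bij_betw_the_inv_into)
  have "cut_point p q c (\<phi> t) t" if t: "0 < t" "t < 1" for t
  proof -
    have \<psi>\<phi>: "\<psi> (\<phi> t) = t"
      unfolding \<phi>_def using \<psi>_bij t by (intro f_the_inv_into_f_bij_betw) auto
    have "\<phi> t \<in> {0..1}" using bij t by (auto simp: bij_betw_def)
    moreover have "\<phi> t \<noteq> 0" "\<phi> t \<noteq> 1" using \<psi>\<phi> \<psi>0 \<psi>1 t by auto
    ultimately have \<phi>: "0 < \<phi> t" "\<phi> t < 1" by auto
    define M where "M = - ln (\<phi> t)"
    have M: "0 \<le> M" using \<phi> by (simp add: M_def)
    have gM: "ln t = - g M"
      using \<psi>[of "\<phi> t"] \<phi> \<psi>\<phi> by (metis M_def less_imp_le ln_exp)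
    have upper: "\<psi> s \<le> s powr a * (1 - ln s) powr (1 - a)" if "0 < s" "s < 1" for s
    proof -
      have "ln s \<le> a * ln s" "a * ln s \<le> 0"
        using that a a1 by (auto simp: mult_le_cancel_right2 mult_nonneg_nonpos)
      then show ?thesis
        unfolding \<psi>_def using that a1 by (intro mult_left_mono powr_mono2) auto
    qed
    have H1: "\<phi> t powr a * (1 - ln (\<phi> t)) powr (1 - a) \<le> c * t"
    proof -
      have "1 - ln (\<phi> t) \<le> (1 / a) * (1 - a * ln (\<phi> t))"
        using a ca by (simp add: algebra_simps)
      then have "(1 - ln (\<phi> t)) powr (1 - a) \<le> ((1 / a) * (1 - a * ln (\<phi> t))) powr (1 - a)"
        using a1 ln_less_one[of "\<phi> t"] \<phi> by (intro powr_mono2) auto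
      also have "\<dots> = (1 / a) powr (1 - a) * (1 - a * ln (\<phi> t)) powr (1 - a)"
        by (rule powr_mult)
      also have "\<dots> \<le> (1 / a) powr 1 * (1 - a * ln (\<phi> t)) powr (1 - a)"
        using ca a by (intro mult_right_mono powr_mono) auto
      also have "\<dots> \<le> c * (1 - a * ln (\<phi> t)) powr (1 - a)"
        using ca a by (intro mult_right_mono) auto
      finally have "\<phi> t powr a * (1 - ln (\<phi> t)) powr (1 - a) \<le> \<phi> t powr a * (c * (1 - a * ln (\<phi> t)) powr (1 - a))"
        by (intro mult_left_mono) auto
      also have "\<dots> = c * \<psi> (\<phi> t)" by (simp add: \<psi>_def)
      finally show ?thesis by (simp add: \<psi>\<phi>)
    qed
    have H2: "t \<le> s powr a * (1 - ln s) powr (1 - a)" if "\<phi> t \<le> s" "s < 1" for s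
    proof -
      have "t \<le> \<psi> s"
        using \<psi>_less[of "\<phi> t" s] \<psi>\<phi> \<phi> that by (cases "\<phi> t = s") auto
      then show ?thesis using upper[of s] that \<phi> by simp
    qed
    have "g M \<le> a * M" "a\<^sup>2 * M \<le> g M" using g[of 0 M] M by (simp_all add: g0)
    moreover have "a * M \<le> M" using a1 M by (simp add: mult_left_le_one_le a less_imp_le)
    ultimately have H3: "1 - ln t \<le> 1 - ln (\<phi> t)" and "a\<^sup>2 * M \<le> g M"
      using gM by (auto simp: M_def)
    have "1 - ln (\<phi> t) \<le> c * (1 - ln t)"
    proof -
      have "M \<le> c * g M" using \<open>a\<^sup>2 * M \<le> g M\<close> a by (simp add: c_def field_simps)
      then show ?thesis using gM ca by (simp add: M_def algebra_simps)
    qed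
    then show ?thesis
      unfolding cut_point_def using \<phi> t ca H1 H2 H3 by (auto simp: a_def)
  qed
  with bij show ?thesis by (intro exI[of _ \<phi>] exI[of _ c]) auto
qed

section \<open>Decreasing rearrangements\<close>

lemma distrib_fun_antimono_level:
  assumes "\<Omega> \<in> sets lebesgue" "f \<in> borel_measurable lebesgue" "y \<le> z"
  shows "distrib_fun \<Omega> f z \<le> distrib_fun \<Omega> f y"
proof -
  note [measurable] = assms(1,2)
  show ?thesis
    unfolding distrib_fun_def using assms(3) by (intro emeasure_mono) auto
qed

text \<open>The superlevel sets of a real function shrink to the empty set, and continuity from
  above applies as \<Omega> has finite measure. So for \<open>s > 0\<close> the infimum in
  \<open>rearr\<close> runs over a nonempty set.\<close>

lemma ex_distrib_fun_le:
  assumes "\<Omega> \<in> sets lebesgue" "emeasure lebesgue \<Omega> < \<infinity>" "f \<in> borel_measurable lebesgue" "0 < s"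
  shows "\<exists>y\<ge>0. distrib_fun \<Omega> f y \<le> ennreal s"
proof -
  note [measurable] = assms(1,3)
  define A where "A = (\<lambda>n::nat. {x \<in> \<Omega>. \<bar>f x\<bar> > real n})"
  have A: "range A \<subseteq> sets lebesgue" unfolding A_def by auto
  have "(\<lambda>n. emeasure lebesgue (A n)) \<longlonglongrightarrow> emeasure lebesgue (\<Inter>n. A n)"
  proof (intro Lim_emeasure_decseq A)
    show "decseq A" unfolding A_def decseq_def by (auto intro: order.strict_trans1[rotated])
    have "emeasure lebesgue (A n) \<le> emeasure lebesgue \<Omega>" for n
      using assms(1) by (intro emeasure_mono) (auto simp: A_def)
    then show "emeasure lebesgue (A n) \<noteq> \<infinity>" for n
      using assms(2) by (metis infinity_ennreal_def leD)
  qed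
  also have "(\<Inter>n. A n) = {}"
  proof -
    have "\<not> (\<forall>n. x \<in> A n)" for x
      using reals_Archimedean2[of "\<bar>f x\<bar>"] by (auto simp: A_def not_less intro: less_imp_le)
    then show ?thesis by auto
  qed
  finally have "(\<lambda>n. emeasure lebesgue (A n)) \<longlonglongrightarrow> 0" by simp
  then have "eventually (\<lambda>n. emeasure lebesgue (A n) < ennreal s) sequentially"
    using assms(4) by (intro order_tendstoD(2)) auto
  then obtain n where "emeasure lebesgue (A n) < ennreal s"
    by (auto simp: eventually_sequentially)
  then show ?thesis
    by (intro exI[of _ "real n"]) (auto simp: distrib_fun_def A_def)
qed

lemma rearr_le:
  assumes "0 \<le> y" "distrib_fun \<Omega> f y \<le> ennreal s"
  shows "rearr \<Omega> f s \<le> y"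
  unfolding rearr_def using assms by (intro cInf_lower) (auto intro: bdd_belowI[of _ 0])

context
  fixes \<Omega> :: "'a::euclidean_space set"
  assumes \<Omega>: "\<Omega> \<in> sets lebesgue" "emeasure lebesgue \<Omega> < \<infinity>"
begin

lemma rearr_nonneg:
  assumes "f \<in> borel_measurable lebesgue" "0 < s"
  shows "0 \<le> rearr \<Omega> f s"
  unfolding rearr_def using ex_distrib_fun_le[OF \<Omega> assms] by (intro cInf_greatest) auto

lemma decr_rearr:
  assumes "f \<in> borel_measurable lebesgue"
  shows "decr (rearr \<Omega> f)"
  unfolding decr_def
proof (intro conjI allI impI)
  fix s u :: real assume "0 < s" "s \<le> u"
  with ex_distrib_fun_le[OF \<Omega> assms, of s] show "rearr \<Omega> f u \<le> rearr \<Omega> f s"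
    unfolding rearr_def
    by (intro cInf_superset_mono) (auto intro: bdd_belowI[of _ 0] order_trans ennreal_leI)
qed (use rearr_nonneg[OF assms] in auto)

text \<open>The infimum is attained: the set where \<open>\<bar>f\<bar>\<close> exceeds
  \<open>r\<close> is the increasing union of the sets where it exceeds \<open>r + 1/n\<close>, and
  each of these has measure at most \<open>s\<close>.\<close>

lemma distrib_fun_rearr:
  assumes f: "f \<in> borel_measurable lebesgue" and "0 < s"
  shows "distrib_fun \<Omega> f (rearr \<Omega> f s) \<le> ennreal s"
proof -
  note [measurable] = \<Omega>(1) f
  define r where "r = rearr \<Omega> f s"
  have above: "distrib_fun \<Omega> f y \<le> ennreal s" if "r < y" for y
  proof -
    have "{y. 0 \<le> y \<and> distrib_fun \<Omega> f y \<le> ennreal s} \<noteq> {}"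
      using ex_distrib_fun_le[OF \<Omega> assms] by auto
    from cInf_lessD[OF this] that obtain z where "z < y" "distrib_fun \<Omega> f z \<le> ennreal s"
      unfolding r_def rearr_def by auto
    then show ?thesis
      using distrib_fun_antimono_level[OF \<Omega>(1) f, of z y] by (auto intro: order_trans)
  qed
  define A where "A = (\<lambda>n::nat. {x \<in> \<Omega>. \<bar>f x\<bar> > r + 1 / real (Suc n)})"
  have "{x \<in> \<Omega>. \<bar>f x\<bar> > r} = (\<Union>n. A n)"
  proof (intro equalityI subsetI)
    fix x assume x: "x \<in> {x \<in> \<Omega>. \<bar>f x\<bar> > r}"
    then obtain n where "1 / real (Suc n) < \<bar>f x\<bar> - r"
      using nat_approx_posE[of "\<bar>f x\<bar> - r"] by auto
    with x show "x \<in> (\<Union>n. A n)" by (auto simp: A_def intro!: exI[of _ n])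
  next
    fix x assume "x \<in> (\<Union>n. A n)"
    then obtain n where "x \<in> \<Omega>" "\<bar>f x\<bar> > r + 1 / real (Suc n)" by (auto simp: A_def)
    moreover have "0 < 1 / real (Suc n)" by simp
    ultimately have "x \<in> \<Omega>" "r < \<bar>f x\<bar>" by linarith+
    then show "x \<in> {x \<in> \<Omega>. \<bar>f x\<bar> > r}" by simp
  qed
  then have "distrib_fun \<Omega> f r = emeasure lebesgue (\<Union>n. A n)"
    by (simp add: distrib_fun_def)
  also have "\<dots> = (SUP n. emeasure lebesgue (A n))"
  proof (intro SUP_emeasure_incseq[symmetric])
    show "range A \<subseteq> sets lebesgue" unfolding A_def by auto
    show "incseq A"
    proof (intro incseq_SucI subsetI)
      fix n x assume "x \<in> A n"
      moreover have "1 / real (Suc (Suc n)) \<le> 1 / real (Suc n)" by (intro divide_left_mono) auto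
      ultimately show "x \<in> A (Suc n)" by (auto simp: A_def)
    qed
  qed
  also have "\<dots> \<le> ennreal s"
    using above by (intro SUP_least) (auto simp: A_def distrib_fun_def[symmetric])
  finally show ?thesis by (simp add: r_def)
qed

lemma rearr_mono:
  assumes "f \<in> borel_measurable lebesgue" "0 < s" "\<And>x. x \<in> \<Omega> \<Longrightarrow> \<bar>g x\<bar> \<le> \<bar>f x\<bar>"
  shows "rearr \<Omega> g s \<le> rearr \<Omega> f s"
proof (intro rearr_le rearr_nonneg assms)
  note [measurable] = \<Omega>(1) assms(1)
  have "distrib_fun \<Omega> g (rearr \<Omega> f s) \<le> distrib_fun \<Omega> f (rearr \<Omega> f s)"
    unfolding distrib_fun_def using assms(3) by (intro emeasure_mono) (force, measurable)
  also have "\<dots> \<le> ennreal s" using assms by (intro distrib_fun_rearr)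
  finally show "distrib_fun \<Omega> g (rearr \<Omega> f s) \<le> ennreal s" .
qed

text \<open>If \<open>\<bar>f x\<bar>\<close> exceeds \<open>a + b\<close>, then
  \<open>\<bar>g x\<bar>\<close> exceeds \<open>a\<close> or \<open>\<bar>h x\<bar>\<close> exceeds
  \<open>b\<close>. With the rearrangements at \<open>s / 2\<close> as levels, each of the two sets
  has measure at most \<open>s / 2\<close>.\<close>

lemma rearr_add_le:
  assumes g: "g \<in> borel_measurable lebesgue" and h: "h \<in> borel_measurable lebesgue" and s: "0 < s"
    and f: "\<And>x. x \<in> \<Omega> \<Longrightarrow> f x = g x + h x"
  shows "rearr \<Omega> f s \<le> rearr \<Omega> g (s / 2) + rearr \<Omega> h (s / 2)"
proof (intro rearr_le add_nonneg_nonneg rearr_nonneg g h)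
  note [measurable] = \<Omega>(1) g h
  let ?a = "rearr \<Omega> g (s / 2)" and ?b = "rearr \<Omega> h (s / 2)"
  have "distrib_fun \<Omega> f (?a + ?b)
      \<le> emeasure lebesgue ({x \<in> \<Omega>. \<bar>g x\<bar> > ?a} \<union> {x \<in> \<Omega>. \<bar>h x\<bar> > ?b})"
    unfolding distrib_fun_def
  proof (intro emeasure_mono subsetI)
    fix x assume "x \<in> {x \<in> \<Omega>. \<bar>f x\<bar> > ?a + ?b}"
    then show "x \<in> {x \<in> \<Omega>. \<bar>g x\<bar> > ?a} \<union> {x \<in> \<Omega>. \<bar>h x\<bar> > ?b}"
      using f[of x] abs_triangle_ineq[of "g x" "h x"] by auto
  qed measurable
  also have "\<dots> \<le> distrib_fun \<Omega> g ?a + distrib_fun \<Omega> h ?b"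
    unfolding distrib_fun_def by (intro emeasure_subadditive) measurable
  also have "\<dots> \<le> ennreal (s / 2) + ennreal (s / 2)"
    using g h s by (intro add_mono distrib_fun_rearr) auto
  also have "\<dots> = ennreal s"
    using s by (simp add: ennreal_plus[symmetric] del: ennreal_plus)
  finally show "distrib_fun \<Omega> f (?a + ?b) \<le> ennreal s" .
qed (use s in auto)

text \<open>Because the cut is strict, \<open>g\<close> is nonzero exactly where
  \<open>\<bar>f\<bar>\<close> exceeds the level, a set of measure at most \<phi>; its rearrangement
  therefore vanishes from \<phi> on, the point \<phi> included. Values equal to the level stay in
  the bounded part.\<close>

lemma rearr_truncation:
  fixes f :: "'a \<Rightarrow> real" and \<phi> :: real
  assumes f: "f \<in> borel_measurable lebesgue" and \<phi>: "0 < \<phi>"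
  defines "g \<equiv> \<lambda>x. if rearr \<Omega> f \<phi> < \<bar>f x\<bar> then f x else 0"
  shows "\<phi> \<le> s \<Longrightarrow> rearr \<Omega> g s = 0"
    and "0 < s \<Longrightarrow> rearr \<Omega> (\<lambda>x. f x - g x) s \<le> rearr \<Omega> f \<phi>"
proof -
  note [measurable] = \<Omega>(1) f
  define r where "r = rearr \<Omega> f \<phi>"
  have r: "0 \<le> r" unfolding r_def by (intro rearr_nonneg f \<phi>)
  have g: "g \<in> borel_measurable lebesgue" unfolding g_def by measurable
  show "rearr \<Omega> g s = 0" if "\<phi> \<le> s"
  proof (intro antisym rearr_le rearr_nonneg g)
    have "{x \<in> \<Omega>. \<bar>g x\<bar> > 0} = {x \<in> \<Omega>. \<bar>f x\<bar> > r}"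
      using r by (auto simp: g_def r_def)
    then have "distrib_fun \<Omega> g 0 = distrib_fun \<Omega> f r" by (simp add: distrib_fun_def)
    also have "\<dots> \<le> ennreal \<phi>" unfolding r_def by (intro distrib_fun_rearr f \<phi>)
    also have "\<dots> \<le> ennreal s" using that by (rule ennreal_leI)
    finally show "distrib_fun \<Omega> g 0 \<le> ennreal s" .
  qed (use that \<phi> in auto)
  have "{x \<in> \<Omega>. \<bar>f x - g x\<bar> > r} = {}"
    using r by (auto simp: g_def r_def)
  then have "distrib_fun \<Omega> (\<lambda>x. f x - g x) r = 0"
    unfolding distrib_fun_def by (metis (no_types, lifting) emeasure_empty)
  then show "0 < s \<Longrightarrow> rearr \<Omega> (\<lambda>x. f x - g x) s \<le> rearr \<Omega> f \<phi>"
    using r by (intro rearr_le) (auto simp: r_def)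
qed

end

section \<open>The K-functional of the couple\<close>

lemma rint_eq_powint: "rint \<Omega> f p a b = powint (rearr \<Omega> f) p a b"
  by (simp add: rint_def powint_def)

lemma small_norm_eq_small_part: "small_norm \<Omega> p f = small_part (rearr \<Omega> f) p 1"
  by (simp add: small_norm_def small_part_def lnorm_def rint_eq_powint)

lemma grand_norm_eq_grand_part: "grand_norm \<Omega> q f = grand_part (rearr \<Omega> f) q 0"
  by (simp add: grand_norm_def grand_part_def lnorm_def rint_eq_powint)

theorem theorem5p2:
  fixes \<Omega> :: "'a::euclidean_space set" and p q :: real
  assumes "open \<Omega>" and "bounded \<Omega>" and "emeasure lebesgue \<Omega> = 1"
    and "1 < p" and "p < q"
  shows "\<exists>\<phi> :: real \<Rightarrow> real. \<exists>c::real.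
     bij_betw \<phi> {0..1} {0..1} \<and> c \<ge> 1 \<and>
     (\<forall>t\<in>{0<..<1}.
        t / c \<le> \<phi> t powr (1/p - 1/q) * (1 - ln (\<phi> t)) powr ((p - q + p*q) / (p*q)) \<and>
        \<phi> t powr (1/p - 1/q) * (1 - ln (\<phi> t)) powr ((p - q + p*q) / (p*q)) \<le> c * t) \<and>
     (\<exists>C::real. C > 0 \<and>
       (\<forall>f t. in_sum_space \<Omega> p q f \<longrightarrow> t \<in> {0<..<1} \<longrightarrow>
          (let R = (\<integral>\<^sup>+ s. indicator {0<..<\<phi> t} s *
                      ennreal ((1 - ln s) powr (-1/p) / s) * ennpow (rint \<Omega> f p 0 s) (1/p) \<partial>lborel)
                   + ennreal ((1 - ln t) powr ((p - 1) / p)) * ennpow (rint \<Omega> f p 0 (\<phi> t)) (1/p)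
                   + ennreal t * (SUP s\<in>{\<phi> t<..<1}.
                        ennreal ((1 - ln s) powr (-1/q)) * ennpow (rint \<Omega> f q s 1) (1/q))
           in Kfun \<Omega> p q f t \<le> ennreal C * R \<and> R \<le> ennreal C * Kfun \<Omega> p q f t)))"
proof -
  note pq = assms(4,5)
  have \<Omega>: "\<Omega> \<in> sets lebesgue" "emeasure lebesgue \<Omega> < \<infinity>"
    using assms by (auto simp: lborelD)
  obtain \<phi> c where bij: "bij_betw \<phi> {0..1} {0..1::real}"
    and cp: "\<And>t. 0 < t \<Longrightarrow> t < 1 \<Longrightarrow> cut_point p q c (\<phi> t) t"
    using ex_cut_point[OF pq] by (metis greaterThanLessThan_iff)
  have c: "1 \<le> c" using cp[of "1/2"] by (simp add: cut_point_def)
  have expo: "(p - q + p*q) / (p*q) = 1 - (1/p - 1/q)"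
    using pq by (simp add: field_simps)
  obtain A where A: "A > 0" "\<And>F h k \<phi> t. cut_point p q c \<phi> t \<and> decr F \<and> decr h \<and> decr k \<and>
      (\<forall>s. 0 < s \<and> s < 1 \<longrightarrow> h s \<le> F s \<and> k s \<le> F s \<and> k s \<le> F \<phi>) \<and>
      (\<forall>s. \<phi> \<le> s \<and> s < 1 \<longrightarrow> h s = 0) \<Longrightarrow>
    small_part h p 1 + ennreal t * grand_part k q 0 \<le> ennreal A * Kterm F p q \<phi> t"
    using Kterm_upper[OF pq c] by blast
  obtain B where B: "B > 0" "\<And>F h k \<phi> t. cut_point p q c \<phi> t \<and> decr h \<and> decr k \<and>
      (\<forall>s. 0 < s \<and> s < 1 \<longrightarrow> 0 \<le> F s \<and> F s \<le> h (s / 2) + k (s / 2)) \<Longrightarrow>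
    Kterm F p q \<phi> t \<le> ennreal B * (small_part h p 1 + ennreal t * grand_part k q 0)"
    using Kterm_lower[OF pq c] by blast
  have main: "Kfun \<Omega> p q f t \<le> ennreal (max A B) * Kterm (rearr \<Omega> f) p q (\<phi> t) t \<and>
      Kterm (rearr \<Omega> f) p q (\<phi> t) t \<le> ennreal (max A B) * Kfun \<Omega> p q f t"
    if fs: "in_sum_space \<Omega> p q f" and t: "0 < t" "t < 1" for f t
  proof
    have f[measurable]: "f \<in> borel_measurable lebesgue"
      using fs by (simp add: in_sum_space_def)
    have \<phi>: "0 < \<phi> t" using cp[OF t] by (simp add: cut_point_def)
    let ?R = "Kterm (rearr \<Omega> f) p q (\<phi> t) t"
    define f0 where "f0 = (\<lambda>x. if rearr \<Omega> f (\<phi> t) < \<bar>f x\<bar> then f x else 0)"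
    define f1 where "f1 = (\<lambda>x. f x - f0 x)"
    have f01[measurable]: "f0 \<in> borel_measurable lebesgue" "f1 \<in> borel_measurable lebesgue"
      unfolding f0_def f1_def by measurable
    have "(f0, f1) \<in> decomps \<Omega> f"
      using f01 by (simp add: decomps_def f1_def)
    then have "Kfun \<Omega> p q f t \<le> small_norm \<Omega> p f0 + ennreal t * grand_norm \<Omega> q f1"
      unfolding Kfun_def by (rule INF_lower2) simp
    also have "\<dots> \<le> ennreal A * ?R"
      unfolding small_norm_eq_small_part grand_norm_eq_grand_part
    proof (intro A(2) conjI allI impI cp t decr_rearr[OF \<Omega>] f f01)
      fix s :: real
      show "0 < s \<and> s < 1 \<Longrightarrow> rearr \<Omega> f0 s \<le> rearr \<Omega> f s"
        by (intro rearr_mono[OF \<Omega> f]) (auto simp: f0_def)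
      show "0 < s \<and> s < 1 \<Longrightarrow> rearr \<Omega> f1 s \<le> rearr \<Omega> f s"
        by (intro rearr_mono[OF \<Omega> f]) (auto simp: f1_def f0_def)
      show "0 < s \<and> s < 1 \<Longrightarrow> rearr \<Omega> f1 s \<le> rearr \<Omega> f (\<phi> t)"
        using rearr_truncation(2)[OF \<Omega> f \<phi>] by (simp add: f1_def f0_def)
      show "\<phi> t \<le> s \<and> s < 1 \<Longrightarrow> rearr \<Omega> f0 s = 0"
        using rearr_truncation(1)[OF \<Omega> f \<phi>] by (simp add: f0_def)
    qed
    also have "\<dots> \<le> ennreal (max A B) * ?R"
      by (intro mult_right_mono ennreal_leI) auto
    finally show "Kfun \<Omega> p q f t \<le> ennreal (max A B) * ?R" .
    \<comment> \<open>The constant is moved to the left so that the claim is a plain lower bound for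
      every member of the infimum; it is multiplied back afterwards.\<close>
    have "ennreal (1 / B) * ?R \<le> Kfun \<Omega> p q f t"
      unfolding Kfun_def
    proof (intro INF_greatest)
      fix d assume "d \<in> decomps \<Omega> f"
      then obtain g h where d: "d = (g, h)" and [simp]: "g \<in> borel_measurable lebesgue" "h \<in> borel_measurable lebesgue"
        and fgh: "\<And>x. x \<in> \<Omega> \<Longrightarrow> f x = g x + h x"
        by (auto simp: decomps_def)
      have "?R \<le> ennreal B * (small_part (rearr \<Omega> g) p 1 + ennreal t * grand_part (rearr \<Omega> h) q 0)"
        using rearr_nonneg[OF \<Omega> f] rearr_add_le[OF \<Omega> _ _ _ fgh] cp[OF t]
        by (intro B(2) conjI allI impI decr_rearr[OF \<Omega>]) auto
      then have "ennreal (1 / B) * ?R \<le> ennreal (1 / B) * (ennreal B * (small_part (rearr \<Omega> g) p 1 + ennreal t * grand_part (rearr \<Omega> h) q 0))"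
        by (intro mult_left_mono) auto
      also have "\<dots> = small_part (rearr \<Omega> g) p 1 + ennreal t * grand_part (rearr \<Omega> h) q 0"
        using B(1) by (simp add: mult.assoc[symmetric] ennreal_mult[symmetric] del: distrib_left)
      finally show "ennreal (1 / B) * ?R \<le> small_norm \<Omega> p (fst d) + ennreal t * grand_norm \<Omega> q (snd d)"
        by (simp add: d small_norm_eq_small_part grand_norm_eq_grand_part)
    qed
    then have "ennreal B * (ennreal (1 / B) * ?R) \<le> ennreal B * Kfun \<Omega> p q f t"
      by (intro mult_left_mono) auto
    also have "ennreal B * (ennreal (1 / B) * ?R) = ?R"
      using B(1) by (simp add: mult.assoc[symmetric] ennreal_mult[symmetric])
    also have "ennreal B * Kfun \<Omega> p q f t \<le> ennreal (max A B) * Kfun \<Omega> p q f t"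
      by (intro mult_right_mono ennreal_leI) auto
    finally show "?R \<le> ennreal (max A B) * Kfun \<Omega> p q f t" .
  qed
  show ?thesis
  proof (intro exI conjI ballI)
    show "bij_betw \<phi> {0..1} {0..1}" by (rule bij)
    show "1 \<le> c" by (rule c)
    show "0 < max A B" using A(1) by simp
    fix t :: real assume t: "t \<in> {0<..<1}"
    \<comment> \<open>The construction gives the lower estimate with constant 1, so \<open>c\<close>
      merely weakens it.\<close>
    have "t / c \<le> t" using t c by (simp add: field_simps mult_left_le)
    with cp[of t] t show "t / c \<le> \<phi> t powr (1/p - 1/q) * (1 - ln (\<phi> t)) powr ((p - q + p*q) / (p*q))"
      unfolding expo cut_point_def by force
    from cp[of t] t show "\<phi> t powr (1/p - 1/q) * (1 - ln (\<phi> t)) powr ((p - q + p*q) / (p*q)) \<le> c * t"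
      unfolding expo cut_point_def by auto
  next
    show "\<forall>f t. in_sum_space \<Omega> p q f \<longrightarrow> t \<in> {0<..<1} \<longrightarrow>
          (let R = (\<integral>\<^sup>+ s. indicator {0<..<\<phi> t} s *
                      ennreal ((1 - ln s) powr (-1/p) / s) * ennpow (rint \<Omega> f p 0 s) (1/p) \<partial>lborel)
                   + ennreal ((1 - ln t) powr ((p - 1) / p)) * ennpow (rint \<Omega> f p 0 (\<phi> t)) (1/p)
                   + ennreal t * (SUP s\<in>{\<phi> t<..<1}.
                        ennreal ((1 - ln s) powr (-1/q)) * ennpow (rint \<Omega> f q s 1) (1/q))
           in Kfun \<Omega> p q f t \<le> ennreal (max A B) * R \<and> R \<le> ennreal (max A B) * Kfun \<Omega> p q f t)"
      using main
      unfolding Let_def rint_eq_powint Kterm_def small_part_def grand_part_def lnorm_def by auto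
  qed
qed

end
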